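(* Let $n$ be a positive integer and let $f_{\mathrm{inv}}:\mathbb F_{2^n}\to\mathbb F_{2^n}$ be defined by $f_{\mathrm{inv}}(x)=x^{-1}$ for $x\neq 0$ and $f_{\mathrm{inv}}(0)=0$. Then for every integer $k$ with $3\le k\le \frac{3}{13}n+0.461$, the function $f_{\mathrm{inv}}$ is not $k$th order sum-free.
   Context: A function $f:\mathbb F_{2^n}\to\mathbb F_{2^n}$ is called $k$th order sum-free if for every $k$-dimensional affine subspace $X$ of $\mathbb F_{2^n}$ (viewed as a vector space over $\mathbb F_2$) one has $\sum_{x\in X} f(x)\neq 0$. *)

theory Defs
  imports Main Complex_Main
begin

text \<open>An F_2-linear subspace of a field of characteristic 2: a set containing 0
  and closed under addition (scalars are only 0 and 1).\<close>
definition F2_subspace :: "'a::field set \<Rightarrow> bool" where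
  "F2_subspace V \<longleftrightarrow> 0 \<in> V \<and> (\<forall>x\<in>V. \<forall>y\<in>V. x + y \<in> V)"

definition F2_affine_subspace :: "nat \<Rightarrow> 'a::field set \<Rightarrow> bool" where
  "F2_affine_subspace k X \<longleftrightarrow>
     (\<exists>a V. F2_subspace V \<and> finite V \<and> card V = 2 ^ k \<and> X = (\<lambda>v. a + v) ` V)"

definition kth_order_sum_free :: "nat \<Rightarrow> ('a::field \<Rightarrow> 'a) \<Rightarrow> bool" where
  "kth_order_sum_free k f \<longleftrightarrow> (\<forall>X. F2_affine_subspace k X \<longrightarrow> (\<Sum>x\<in>X. f x) \<noteq> 0)"

definition f_inv :: "'a::field \<Rightarrow> 'a" where
  "f_inv x = (if x = 0 then 0 else inverse x)"

end

theory Submission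
  imports Defs
begin

text \<open>Write \<open>s(V)\<close> for the sum of the inverses of the nonzero elements of a subspace \<open>V\<close>; a
  \<open>k\<close>-dimensional \<open>V\<close> with \<open>s(V) = 0\<close> is wanted. For \<open>e\<close> outside a subspace \<open>J\<close> the sum
  \<open>c(J, e)\<close> of the inverses over the coset \<open>e + J\<close> satisfies \<open>s(J + e) = s(J) + c(J, e)\<close> and is the
  inverse of an additive polynomial in \<open>e\<close> with kernel \<open>J\<close>. The characters trivial on the image of
  this polynomial are given by \<open>0\<close> and the values \<open>c(I, f)\<close> for the hyperplanes \<open>I\<close> of \<open>J\<close>, with
  \<open>f\<close> in \<open>J\<close> but not in \<open>I\<close>. Hence character sums over pairs \<open>(J, e)\<close> reduce to the same kind of
  sums in one dimension less: if \<open>N\<^sub>p(x)\<close> counts the pairs with \<open>dim J = p\<close> and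
  \<open>c(J, e) / s(J + e) = x\<close>, then, up to an explicit constant, \<open>N\<^sub>p(x)\<close> is the Fourier transform of
  \<open>N\<^sub>p\<^sub>-\<^sub>1\<close> at \<open>1 + 1/x\<close>, divided by \<open>2^(p - 1)\<close>. By Parseval the nontrivial frequencies of \<open>N\<^sub>p\<close> stay
  small in mean square, whereas the absence of the wanted \<open>V\<close> would make the frequency \<open>1\<close> of
  \<open>N\<^sub>k\<^sub>-\<^sub>2\<close> large. This settles \<open>k \<ge> 4\<close>; for \<open>k = 3\<close> the frequency in question is a single
  Kloosterman sum, which Kloosterman's fourth moment argument bounds.\<close>

section \<open>Subspaces in characteristic two\<close>

definition ext :: "'a::field set \<Rightarrow> 'a \<Rightarrow> 'a set" where
  "ext I f = I \<union> (\<lambda>v. f + v) ` I"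

text \<open>Since \<open>inverse 0 = 0\<close>, the element \<open>0\<close> contributes nothing.\<close>

definition inv_sum :: "'a::field set \<Rightarrow> 'a" where
  "inv_sum J = (\<Sum>v\<in>J. inverse v)"

definition coset_inv_sum :: "'a::field set \<Rightarrow> 'a \<Rightarrow> 'a" where
  "coset_inv_sum J e = (\<Sum>v\<in>J. inverse (e + v))"

text \<open>Off \<open>J\<close> the coset sum is the logarithmic derivative of the product of all
  \<open>e + v\<close> with \<open>v\<close> in \<open>J\<close>. Since that product is additive in
  \<open>e\<close>, its derivative is constant, so \<open>ell J\<close> is the subspace polynomial
  of \<open>J\<close> up to a scalar. The value \<open>0\<close> on \<open>J\<close> makes it
  additive everywhere; the inverse of the coset sum would be wrong there.\<close>

definition ell :: "'a::field set \<Rightarrow> 'a \<Rightarrow> 'a" where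
  "ell J e = (if e \<in> J then 0 else inverse (coset_inv_sum J e))"

definition subspaces :: "nat \<Rightarrow> 'a::field set set" where
  "subspaces p = {J. F2_subspace J \<and> card J = 2 ^ p}"

text \<open>In characteristic two additive characters take only the values 1 and -1, so real sums
  suffice. Invariance under squaring is the decisive property: it makes \<open>psi\<close> trivial
  on all elements \<open>t + t^2\<close>.\<close>

locale char2_character =
  fixes psi :: "'a::{field,finite} \<Rightarrow> real" and q :: real
  assumes card_UNIV_eq [simp]: "real (card (UNIV :: 'a set)) = q"
    and two_eq_0: "(2::'a) = 0"
    and psi_add: "psi (x + y) = psi x * psi y"
    and psi_values: "psi x = 1 \<or> psi x = -1"
    and psi_square: "psi (x\<^sup>2) = psi x"
    and psi_nontrivial: "\<exists>x. psi x \<noteq> 1"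
begin

lemma add_self [simp]: "(x::'a) + x = 0"
  by (metis mult_2 mult_zero_left two_eq_0)

lemma add_add_self [simp]: "(x::'a) + (x + y) = y" "x + (y + x) = y" "(y + x) + x = y" "(x + y) + x = y"
  by (metis add_self add.assoc add_0 add.commute)+

lemma add_eq_0 [simp]: "(x::'a) + y = 0 \<longleftrightarrow> x = y"
  by (metis add_add_self(1) add_self add_0_right)

lemma uminus_eq [simp]: "- (x::'a) = x"
  by (metis add_self minus_unique)

lemma minus_eq [simp]: "(x::'a) - y = x + y"
  by (metis diff_conv_add_uminus uminus_eq)

lemma add_square: "((x::'a) + y)\<^sup>2 = x\<^sup>2 + y\<^sup>2"
  by (simp add: power2_sum two_eq_0)

lemma square_inj [simp]: "(x::'a)\<^sup>2 = y\<^sup>2 \<longleftrightarrow> x = y"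
  by (simp add: power2_eq_iff)

lemma ex_sqrt: "\<exists>y::'a. y\<^sup>2 = x"
proof -
  have "inj (\<lambda>y::'a. y\<^sup>2)" by (rule injI) simp
  then have "surj (\<lambda>y::'a. y\<^sup>2)" by (simp add: finite_UNIV_inj_surj)
  then show ?thesis by (metis surjD)
qed

lemma psi_zero [simp]: "psi 0 = 1"
  using psi_values[of 0] psi_add[of 0 0] by auto

lemma psi_sq_one [simp]: "psi x * psi x = 1" "(psi x)\<^sup>2 = 1"
  using psi_values[of x] by (auto simp: power2_eq_square)

lemma abs_psi [simp]: "\<bar>psi x\<bar> = 1"
  using psi_values[of x] by auto

lemma F2_subspaceD:
  assumes "F2_subspace (J::'a set)"
  shows "0 \<in> J" "x \<in> J \<Longrightarrow> y \<in> J \<Longrightarrow> x + y \<in> J"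
  using assms by (auto simp: F2_subspace_def)

lemma F2_subspace_add_iff:
  assumes "F2_subspace (J::'a set)" "x \<in> J"
  shows "x + y \<in> J \<longleftrightarrow> y \<in> J" "y + x \<in> J \<longleftrightarrow> y \<in> J"
  using assms F2_subspaceD by (metis add_add_self(1), metis add_add_self(3))

lemma mem_ext: "(x::'a) \<in> ext I f \<longleftrightarrow> x \<in> I \<or> x + f \<in> I"
proof -
  have "x + f \<in> I \<Longrightarrow> x \<in> (\<lambda>v. f + v) ` I"
    by (rule image_eqI[of _ _ "x + f"]) auto
  then show ?thesis by (auto simp: ext_def)
qed

lemma subspace_ext: "F2_subspace (I::'a set) \<Longrightarrow> F2_subspace (ext I f)"
  unfolding F2_subspace_def Ball_def mem_ext
  by (smt (verit) add.assoc add.commute add_0_left add_add_self(1))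

lemma ext_disjoint:
  assumes "F2_subspace (I::'a set)" "f \<notin> I"
  shows "I \<inter> (\<lambda>v. f + v) ` I = {}"
  using assms F2_subspace_add_iff by auto

lemma sum_ext:
  assumes "F2_subspace (I::'a set)" "f \<notin> I"
  shows "sum g (ext I f) = sum g I + (\<Sum>v\<in>I. g (f + v))"
proof -
  have "inj_on (\<lambda>v. f + v) I" by (rule inj_onI) simp
  then show ?thesis
    unfolding ext_def using ext_disjoint[OF assms]
    by (subst sum.union_disjoint) (auto simp: sum.reindex)
qed

lemma card_ext:
  assumes "F2_subspace (I::'a set)" "f \<notin> I"
  shows "card (ext I f) = 2 * card I"
  using sum_ext[OF assms, of "\<lambda>_. 1::nat"] by simp

lemma inv_sum_ext:
  assumes "F2_subspace (I::'a set)" "f \<notin> I"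
  shows "inv_sum (ext I f) = inv_sum I + coset_inv_sum I f"
  unfolding inv_sum_def coset_inv_sum_def by (rule sum_ext[OF assms])

lemma coset_inv_sum_ext:
  assumes "F2_subspace (I::'a set)" "f \<notin> I"
  shows "coset_inv_sum (ext I f) e = coset_inv_sum I e + coset_inv_sum I (e + f)"
  unfolding coset_inv_sum_def by (simp add: sum_ext[OF assms] add.assoc)

lemma ext_eq_ext:
  assumes "F2_subspace (I::'a set)" "f \<in> ext I g" "f \<notin> I"
  shows "ext I f = ext I g"
proof -
  have "f + g \<in> I" using assms by (simp add: mem_ext)
  then have "x + f \<in> I \<longleftrightarrow> x + g \<in> I" for x
    using F2_subspace_add_iff[OF assms(1), of "f + g" "x + f"]
    by (metis add.assoc add_add_self(3) F2_subspace_add_iff(2)[OF assms(1)])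
  then show ?thesis by (auto simp: mem_ext)
qed

text \<open>A maximal subspace of \<open>J\<close> satisfying \<open>P\<close> must be
  \<open>J\<close>, since otherwise a further vector of \<open>J\<close> could be adjoined.\<close>

lemma subspace_induct [consumes 1, case_names zero ext]:
  assumes "F2_subspace (J::'a set)"
    and zero: "P {0}"
    and step: "\<And>I f. F2_subspace I \<Longrightarrow> f \<notin> I \<Longrightarrow> P I \<Longrightarrow> P (ext I f)"
  shows "P J"
proof -
  define A where "A = {I. F2_subspace I \<and> I \<subseteq> J \<and> P I}"
  have "{0} \<in> A" using assms by (auto simp: A_def F2_subspace_def)
  moreover have "finite A" by simp
  ultimately obtain I where I: "I \<in> A" and max: "\<And>K. K \<in> A \<Longrightarrow> I \<subseteq> K \<Longrightarrow> I = K"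
    using finite_has_maximal by (metis empty_iff)
  have "I = J"
  proof (rule ccontr)
    assume "I \<noteq> J"
    then obtain f where f: "f \<in> J" "f \<notin> I" using I by (auto simp: A_def)
    have "ext I f \<subseteq> J"
      using I f assms(1) by (auto simp: A_def ext_def intro!: F2_subspaceD)
    then have "ext I f \<in> A" using I f step subspace_ext by (auto simp: A_def)
    then have "I = ext I f" using max by (auto simp: ext_def)
    moreover have "f \<in> ext I f" using I F2_subspaceD(1) by (auto simp: mem_ext A_def)
    ultimately show False using f by simp
  qed
  then show ?thesis using I by (simp add: A_def)
qed

section \<open>The additive polynomial attached to a subspace\<close>

lemma ell_eq_0_on: "e \<in> J \<Longrightarrow> ell J e = 0"
  by (simp add: ell_def)

text \<open>On an extension, \<open>ell\<close> is the composition with an Artin--Schreier polynomial; this is why it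
  is additive and why its annihilator can be computed.\<close>

lemma ell_ext_aux:
  assumes I: "F2_subspace (I::'a set)" and f: "f \<notin> I"
    and add: "\<And>x y. ell I (x + y) = ell I x + ell I y"
    and ker: "\<And>x. ell I x = 0 \<longleftrightarrow> x \<in> I"
  shows "ell (ext I f) e = ell I e + (ell I e)\<^sup>2 / ell I f"
    and "ell (ext I f) e = 0 \<longleftrightarrow> e \<in> ext I f"
proof -
  have l: "ell I f \<noteq> 0" using f ker by simp
  have *: "ell (ext I f) e = ell I e + (ell I e)\<^sup>2 / ell I f
      \<and> (ell (ext I f) e = 0 \<longleftrightarrow> e \<in> ext I f)"
  proof (cases "e \<in> ext I f")
    case True
    then have "ell I e = 0 \<or> ell I e = ell I f"
      using ker add by (metis mem_ext add_eq_0)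
    then show ?thesis using True l by (auto simp: ell_eq_0_on power2_eq_square)
  next
    case False
    then have e: "e \<notin> I" "e + f \<notin> I" by (auto simp: mem_ext)
    then have n: "ell I e \<noteq> 0" "ell I e + ell I f \<noteq> 0" using ker add by metis+
    have "coset_inv_sum I e = inverse (ell I e)" "coset_inv_sum I (e + f) = inverse (ell I (e + f))"
      using e by (simp_all add: ell_def)
    then have "coset_inv_sum (ext I f) e = inverse (ell I e) + inverse (ell I e + ell I f)"
      by (simp add: coset_inv_sum_ext[OF I f] add)
    also have "\<dots> = (ell I e + (ell I e + ell I f)) / (ell I e * (ell I e + ell I f))"
      using n by (simp add: field_simps del: add_eq_0 add_add_self)
    also have "\<dots> = ell I f / (ell I e * (ell I e + ell I f))" by simp
    finally have "ell (ext I f) e = ell I e * (ell I e + ell I f) / ell I f"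
      using False by (simp add: ell_def)
    moreover have "\<dots> \<noteq> 0" using n l by (simp del: add_eq_0)
    moreover have "ell I e * (ell I e + ell I f) / ell I f = ell I e + (ell I e)\<^sup>2 / ell I f"
      using l by (simp add: field_simps power2_eq_square)
    ultimately show ?thesis using False by simp
  qed
  then show "ell (ext I f) e = ell I e + (ell I e)\<^sup>2 / ell I f"
    and "ell (ext I f) e = 0 \<longleftrightarrow> e \<in> ext I f" by auto
qed

text \<open>Additivity and the kernel are obtained in one induction because
  \<open>ell_ext_aux\<close> needs both for the smaller subspace.\<close>

lemma ell_props:
  assumes "F2_subspace (J::'a set)"
  shows "(\<forall>x y. ell J (x + y) = ell J x + ell J y) \<and> (\<forall>x. ell J x = 0 \<longleftrightarrow> x \<in> J)"
  using assms
proof (induction rule: subspace_induct)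
  case zero
  have "ell {0} x = x" for x :: 'a by (simp add: ell_def coset_inv_sum_def)
  then show ?case by simp
next
  case (ext I f)
  then have l: "ell I f \<noteq> 0" by auto
  note aux = ell_ext_aux[OF ext.hyps(1,2)]
  have "ell (ext I f) (x + y) = ell (ext I f) x + ell (ext I f) y" for x y
    using ext l by (simp add: aux add_square add_divide_distrib algebra_simps)
  moreover have "ell (ext I f) x = 0 \<longleftrightarrow> x \<in> ext I f" for x using ext aux(2) by blast
  ultimately show ?case by blast
qed

lemma ell_add: "F2_subspace (J::'a set) \<Longrightarrow> ell J (x + y) = ell J x + ell J y"
  and ell_eq_0_iff: "F2_subspace J \<Longrightarrow> ell J x = 0 \<longleftrightarrow> x \<in> J"
  using ell_props by blast+

lemma ell_ext:
  assumes "F2_subspace (I::'a set)" "f \<notin> I"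
  shows "ell (ext I f) e = ell I e + (ell I e)\<^sup>2 / ell I f"
  by (rule ell_ext_aux) (use assms ell_add ell_eq_0_iff in auto)

lemma coset_inv_sum_eq: "e \<notin> J \<Longrightarrow> coset_inv_sum J e = inverse (ell J e)"
  by (simp add: ell_def)

lemma coset_inv_sum_nonzero:
  "F2_subspace (J::'a set) \<Longrightarrow> e \<notin> J \<Longrightarrow> coset_inv_sum J e \<noteq> 0"
  using ell_eq_0_iff by (simp add: coset_inv_sum_eq)

section \<open>Characters and annihilators\<close>

lemma sum_psi_mult: "(\<Sum>x\<in>UNIV. psi (b * x)) = (if b = 0 then q else 0)"
proof (cases "b = 0")
  case False
  obtain c where c: "psi c \<noteq> 1" using psi_nontrivial by auto
  have "(\<Sum>x\<in>UNIV. psi (b * x)) = (\<Sum>x\<in>UNIV. psi (b * (x + c / b)))"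
    by (rule sum.reindex_bij_witness[of _ "\<lambda>x. x + c / b" "\<lambda>x. x - c / b"]) auto
  also have "\<dots> = (\<Sum>x\<in>UNIV. psi (b * x)) * psi c"
    using False by (simp add: distrib_left psi_add sum_distrib_right)
  finally show ?thesis using c False by simp
qed simp

lemma sum_psi_additive:
  assumes "\<And>x y. g (x + y) = g x + g y"
  shows "(\<Sum>x\<in>UNIV. psi (g (x::'a))) = (if \<forall>x. psi (g x) = 1 then q else 0)"
proof (cases "\<forall>x. psi (g x) = 1")
  case False
  then obtain c where c: "psi (g c) \<noteq> 1" by auto
  have "(\<Sum>x\<in>UNIV. psi (g x)) = (\<Sum>x\<in>UNIV. psi (g (x + c)))"
    by (rule sum.reindex_bij_witness[of _ "\<lambda>x. x + c" "\<lambda>x. x - c"]) auto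
  also have "\<dots> = (\<Sum>x\<in>UNIV. psi (g x)) * psi (g c)"
    by (simp add: assms psi_add sum_distrib_right)
  finally show ?thesis using c False by auto
qed simp

definition ann :: "'a set \<Rightarrow> 'a set" where
  "ann J = {b. \<forall>x. psi (b * ell J x) = 1}"

lemma zero_in_ann [simp]: "0 \<in> ann J"
  by (simp add: ann_def)

text \<open>Fourier expansion of the indicator of the fibre: after exchanging the sums, only the
  frequencies that are trivial on the image of \<open>ell J\<close> survive.\<close>

lemma card_ell_fiber:
  assumes J: "F2_subspace J"
  shows "real (card {e. ell J e = y}) = (\<Sum>b\<in>ann J. psi (b * y))"
proof -
  have q: "q \<noteq> 0" by (simp flip: card_UNIV_eq)
  have "q * real (card {e. ell J e = y}) = (\<Sum>e\<in>UNIV. if ell J e = y then q else 0)"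
    by (simp add: sum.If_cases)
  also have "\<dots> = (\<Sum>e\<in>UNIV. \<Sum>b\<in>UNIV. psi (b * (ell J e + y)))"
    using sum_psi_mult[of "ell J _ + y"] by (intro sum.cong refl) (simp add: mult.commute)
  also have "\<dots> = (\<Sum>b\<in>UNIV. \<Sum>e\<in>UNIV. psi (b * (ell J e + y)))" by (rule sum.swap)
  also have "\<dots> = (\<Sum>b\<in>UNIV. psi (b * y) * (\<Sum>e\<in>UNIV. psi (b * ell J e)))"
    by (simp add: distrib_left psi_add sum_distrib_left mult.commute)
  also have "\<dots> = (\<Sum>b\<in>UNIV. psi (b * y) * (if b \<in> ann J then q else 0))"
    by (subst sum_psi_additive) (auto simp: ell_add[OF J] distrib_left ann_def)
  also have "\<dots> = q * (\<Sum>b\<in>ann J. psi (b * y))"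
    by (simp add: if_distrib sum.If_cases mult.commute sum_distrib_left cong: if_cong)
  finally show ?thesis using q by simp
qed

text \<open>The fibre over 0 is the kernel \<open>J\<close>, and there every character value in the
  formula is 1.\<close>

lemma card_ann: "F2_subspace J \<Longrightarrow> card (ann J) = card J"
  using card_ell_fiber[of J 0] by (simp add: ell_eq_0_iff)

text \<open>Multiplied by \<open>1 / ell I f\<close>, the polynomial of the extension becomes
  \<open>t + t^2\<close> with \<open>t = ell I x / ell I f\<close>, which \<open>psi\<close> sends
  to 1.\<close>

lemma coset_inv_sum_in_ann:
  assumes "F2_subspace I" "f \<notin> I"
  shows "coset_inv_sum I f \<in> ann (ext I f)"
proof -
  have "psi (coset_inv_sum I f * ell (ext I f) x) = 1" for x
  proof -
    have "coset_inv_sum I f * ell (ext I f) x = ell I x / ell I f + (ell I x / ell I f)\<^sup>2"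
      by (simp add: coset_inv_sum_eq[OF assms(2)] ell_ext[OF assms] divide_inverse
          distrib_left power_mult_distrib power2_eq_square ac_simps)
    then show ?thesis by (simp add: psi_add psi_square)
  qed
  then show ?thesis by (simp add: ann_def)
qed

lemma ext_commute: "ext (ext (I::'a set) f) g = ext (ext I g) f"
  by (auto simp: mem_ext add.commute add.left_commute)

lemma quadratic_two_roots:
  fixes b u v :: 'a
  assumes "b\<^sup>2 + b * (u + v) + u * v = 0"
  shows "b = u \<or> b = v"
proof -
  have "(b + u) * (b + v) = b\<^sup>2 + b * (u + v) + u * v" by (simp add: algebra_simps power2_eq_square)
  then show ?thesis using assms by (metis add_eq_0 mult_eq_0_iff)
qed

text \<open>Converse of \<open>coset_inv_sum_in_ann\<close>. An element \<open>b\<close> of the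
  annihilator for \<open>ext K f\<close> yields an element \<open>b + r\<close> of the one for
  \<open>K\<close>. If it is 0, then \<open>b\<close> belongs to the hyperplane \<open>K\<close>.
  Otherwise it belongs to a hyperplane \<open>I\<close> of \<open>K\<close>, and \<open>b\<close> is
  a root of a quadratic whose roots belong to the two hyperplanes of \<open>ext K f\<close> that
  contain \<open>I\<close> and differ from \<open>K\<close>.\<close>

lemma ann_nonzero:
  assumes "F2_subspace J" "b \<in> ann J" "b \<noteq> 0"
  shows "\<exists>I f. F2_subspace I \<and> f \<notin> I \<and> ext I f = J \<and> b = coset_inv_sum I f"
  using assms
proof (induction arbitrary: b rule: subspace_induct)
  case zero
  have "ell {0} x = x" for x :: 'a by (simp add: ell_def coset_inv_sum_def)
  then have "psi (b * (x / b)) = 1" for x using zero by (simp only: ann_def mem_Collect_eq)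
  then show ?case using psi_nontrivial zero by auto
next
  case (ext K f)
  define l where "l = ell K f"
  have l: "l \<noteq> 0" using ext ell_eq_0_iff by (simp add: l_def)
  \<comment> \<open>The square root turns the quadratic part of \<open>ell (ext K f)\<close> into a
    linear one, since \<open>psi ((r * y)^2) = psi (r * y)\<close>.\<close>
  obtain r where r: "r\<^sup>2 = b / l" using ex_sqrt by metis
  have "psi ((b + r) * ell K x) = 1" for x
  proof -
    have "psi (b * ell (ext K f) x) = psi (b * ell K x + (r * ell K x)\<^sup>2)"
      using r by (simp add: ell_ext[OF ext.hyps] distrib_left power_mult_distrib l_def)
    also have "\<dots> = psi ((b + r) * ell K x)"
      by (simp add: psi_add psi_square distrib_right)
    finally show ?thesis using ext.prems by (simp add: ann_def)
  qed
  then have g: "b + r \<in> ann K" by (simp add: ann_def)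
  show ?case
  proof (cases "b + r = 0")
    case True
    then have "b\<^sup>2 = b / l" using r by simp
    then have "b = inverse l" using ext.prems l by (simp add: field_simps power2_eq_square)
    then show ?thesis using ext.hyps by (metis coset_inv_sum_eq l_def)
  next
    case False
    then obtain I h where I: "F2_subspace I" "h \<notin> I" "ext I h = K" "b + r = coset_inv_sum I h"
      using ext.IH[OF g] by blast
    define H p where "H = ell I h" and "p = ell I f"
    have f: "f \<notin> I" "f + h \<notin> I" using ext.hyps(2) I(3) mem_ext by blast+
    have nz: "H \<noteq> 0" "p \<noteq> 0" "p + H \<noteq> 0"
      using I f ell_eq_0_iff ell_add by (metis H_def p_def)+
    have h: "h \<notin> ext I f" "h \<notin> ext I (f + h)"
      using f I F2_subspaceD(1) by (auto simp: mem_ext add.commute)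
    have "b + r = inverse H" using I by (simp add: H_def coset_inv_sum_eq)
    then have "b\<^sup>2 + r\<^sup>2 = inverse H ^ 2" using add_square by metis
    moreover have lv: "l = p * (p + H) / H"
      using nz ell_ext[OF I(1,2), of f] I(3)
      by (simp add: l_def p_def H_def field_simps power2_eq_square)
    ultimately have eq: "b\<^sup>2 + b * H / (p * (p + H)) + inverse H ^ 2 = 0"
      using r nz by (simp del: add_eq_0 add: field_simps)
    \<comment> \<open>These are the coset sums for \<open>ext I f\<close> and
      \<open>ext I (f + h)\<close>, expressed by \<open>H\<close> and \<open>p\<close>. Their
      product is \<open>H^-2\<close> and their sum is \<open>1 / l\<close>, the coefficients of the
      quadratic for \<open>b\<close>.\<close>
    define u v where "u = p / (H * (H + p))" and "v = (p + H) / (H * p)"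
    have "u * v = inverse H ^ 2"
      using nz by (simp add: u_def v_def field_simps power2_eq_square)
    moreover have "u + v = H / (p * (p + H))"
    proof -
      have "u = p * p / (H * p * (p + H))" "v = (p + H) * (p + H) / (H * p * (p + H))"
        unfolding u_def v_def using nz by (simp_all add: ac_simps del: add_eq_0)
      then have "u + v = (p * p + (p + H) * (p + H)) / (H * p * (p + H))"
        by (simp only: add_divide_distrib)
      also have "p * p + (p + H) * (p + H) = H * H"
        using add_square[of p H] by (simp add: power2_eq_square)
      also have "H * H / (H * p * (p + H)) = H / (p * (p + H))"
        using nz by (simp add: mult.assoc del: add_eq_0)
      finally show ?thesis .
    qed
    ultimately have "b = u \<or> b = v"
      by (intro quadratic_two_roots) (use eq in simp)
    moreover have "u = coset_inv_sum (ext I f) h"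
    proof -
      have "ell (ext I f) h = H + H\<^sup>2 / p"
        by (simp add: ell_ext[OF I(1) f(1)] H_def p_def)
      also have "\<dots> = H * (H + p) / p"
        using nz by (simp add: add_divide_distrib distrib_left power2_eq_square add.commute)
      finally show ?thesis using h by (simp add: coset_inv_sum_eq u_def)
    qed
    moreover have "v = coset_inv_sum (ext I (f + h)) h"
    proof -
      have "ell (ext I (f + h)) h = H + H\<^sup>2 / (p + H)"
        by (simp add: ell_ext[OF I(1) f(2)] ell_add[OF I(1)] H_def p_def)
      also have "\<dots> = (H * (p + H) + H * H) / (p + H)"
        using nz(3) by (simp add: add_divide_distrib power2_eq_square del: add_eq_0)
      also have "H * (p + H) + H * H = H * p" by (simp add: distrib_left add.assoc)
      finally show ?thesis using h by (simp add: coset_inv_sum_eq v_def)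
    qed
    moreover have "ext (ext I f) h = ext K f"
      unfolding I(3)[symmetric] by (rule ext_commute)
    moreover have "ext (ext I (f + h)) h = ext K f"
    proof -
      have "x + h + (f + h) = x + f" for x by (simp add: add.left_commute add.commute)
      then show ?thesis by (auto simp: mem_ext add.assoc simp flip: I(3))
    qed
    ultimately show ?thesis using subspace_ext[OF I(1)] h by metis
  qed
qed

lemma coset_inv_sum_coset:
  assumes "F2_subspace (I::'a set)" "f \<notin> I" "f' \<in> ext I f" "f' \<notin> I"
  shows "coset_inv_sum I f' = coset_inv_sum I f"
proof -
  have "ell I (f' + f) = 0" using assms by (simp add: ell_eq_0_iff mem_ext)
  then show ?thesis using assms by (simp add: coset_inv_sum_eq ell_add)
qed

text \<open>Two distinct hyperplanes are \<open>ext K a\<close> and \<open>ext K b\<close> over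
  their intersection \<open>K\<close>. With \<open>A = ell K a\<close> and
  \<open>B = ell K b\<close>, equal coset sums mean \<open>B + B^2 / A = A + A^2 / B\<close>, hence
  \<open>A = B\<close>. But \<open>A + B = ell K (a + b)\<close> is nonzero because
  \<open>a + b\<close> lies outside \<open>K\<close>.\<close>

lemma hyperplane_unique:
  assumes I: "F2_subspace (I::'a set)" "f \<notin> I" and I': "F2_subspace I'" "f' \<notin> I'"
    and J: "ext I f = ext I' f'"
    and eq: "coset_inv_sum I f = coset_inv_sum I' f'"
  shows "I = I'"
proof (rule ccontr)
  assume "I \<noteq> I'"
  have "card I = card I'" using card_ext[OF I] card_ext[OF I'] J by simp
  then obtain a b where a: "a \<in> I" "a \<notin> I'" and b: "b \<in> I'" "b \<notin> I"
    using \<open>I \<noteq> I'\<close> by (metis card_subset_eq finite subsetI)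
  define K where "K = I \<inter> I'"
  have K: "F2_subspace K" using I I' by (auto simp: K_def F2_subspace_def)
  have aJ: "a \<in> ext I' f'" and bJ: "b \<in> ext I f" using a b J by (auto simp: mem_ext)
  have Ia: "ext K a = I"
  proof -
    have "x \<in> K \<or> x + a \<in> K" if "x \<in> I" for x
    proof -
      have "x \<in> ext I' a" using that J ext_eq_ext[OF I'(1) aJ a(2)] by (auto simp: mem_ext)
      then show ?thesis using that a I(1) by (auto simp: mem_ext K_def intro: F2_subspaceD)
    qed
    moreover have "x \<in> I" if "x + a \<in> K" for x
      using that a F2_subspace_add_iff[OF I(1)] by (auto simp: K_def)
    ultimately show ?thesis by (auto simp: mem_ext K_def)
  qed
  have Ib: "ext K b = I'"
  proof -
    have "x \<in> K \<or> x + b \<in> K" if "x \<in> I'" for x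
    proof -
      have "x \<in> ext I b" using that J ext_eq_ext[OF I(1) bJ b(2)] by (auto simp: mem_ext)
      then show ?thesis using that b I'(1) by (auto simp: mem_ext K_def intro: F2_subspaceD)
    qed
    moreover have "x \<in> I'" if "x + b \<in> K" for x
      using that b F2_subspace_add_iff[OF I'(1)] by (auto simp: K_def)
    ultimately show ?thesis by (auto simp: mem_ext K_def)
  qed
  define A B where "A = ell K a" and "B = ell K b"
  have n: "a \<notin> K" "b \<notin> K" using a b by (auto simp: K_def)
  have "a + b \<notin> I" using a b F2_subspace_add_iff I by blast
  then have "a + b \<notin> K" by (auto simp: K_def)
  then have AB: "A \<noteq> 0" "B \<noteq> 0" "A + B \<noteq> 0"
    using n K ell_eq_0_iff ell_add by (metis A_def B_def)+
  \<comment> \<open>The representatives of the nontrivial cosets may be changed: \<open>b\<close>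
    lies in the common extension but not in \<open>I\<close>, and \<open>a\<close> not in
    \<open>I'\<close>.\<close>
  have "coset_inv_sum I b = coset_inv_sum I' a"
    using eq coset_inv_sum_coset[OF I bJ b(2)] coset_inv_sum_coset[OF I' aJ a(2)] by simp
  then have "ell I b = ell I' a" using a b by (simp add: coset_inv_sum_eq)
  then have "B + B\<^sup>2 / A = A + A\<^sup>2 / B"
    using ell_ext[OF K n(1), of b] ell_ext[OF K n(2), of a] Ia Ib by (simp add: A_def B_def)
  then have "B * (A + B) / A = A * (A + B) / B"
    using AB by (simp add: add_divide_distrib distrib_left power2_eq_square add.commute)
  then have "B * (A + B) * B = A * (A + B) * A"
    by (rule iffD1[OF frac_eq_eq[OF AB(1,2)]])
  then have "(A + B) * (B * B) = (A + B) * (A * A)" by (simp only: ac_simps)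
  then have "B\<^sup>2 = A\<^sup>2" using AB(3) by (simp only: mult_cancel_left power2_eq_square) simp
  then show False using AB by simp
qed

section \<open>Counting pairs of a subspace and a vector outside it\<close>

definition pairs :: "nat \<Rightarrow> ('a set \<times> 'a) set" where
  "pairs p = (SIGMA I:subspaces p. - I)"

definition good_pairs :: "nat \<Rightarrow> ('a set \<times> 'a) set" where
  "good_pairs p = {z \<in> pairs p. inv_sum (ext (fst z) (snd z)) \<noteq> 0}"

text \<open>Invariant under scaling the subspace and the vector by a common nonzero factor. On
  \<open>good_pairs\<close> the denominator is nonzero.\<close>

definition ratio :: "'a set \<times> 'a \<Rightarrow> 'a" where
  "ratio z = coset_inv_sum (fst z) (snd z) / inv_sum (ext (fst z) (snd z))"

definition ratio_count :: "nat \<Rightarrow> 'a \<Rightarrow> real" where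
  "ratio_count p x = real (card {z \<in> good_pairs p. ratio z = x})"

definition ratio_transform :: "nat \<Rightarrow> 'a \<Rightarrow> real" where
  "ratio_transform p t = (\<Sum>z\<in>good_pairs p. psi (t * ratio z))"

definition num_subspaces :: "nat \<Rightarrow> real" where
  "num_subspaces p = real (card (subspaces p :: 'a set set))"

definition num_zero :: "nat \<Rightarrow> real" where
  "num_zero p = real (card {J \<in> subspaces p :: 'a set set. inv_sum J = 0})"

definition num_nonzero :: "nat \<Rightarrow> real" where
  "num_nonzero p = real (card {J \<in> subspaces p :: 'a set set. inv_sum J \<noteq> 0})"

lemma num_split: "num_subspaces p = num_nonzero p + num_zero p"
proof -
  have "(subspaces p :: 'a set set)
      = {J \<in> subspaces p. inv_sum J \<noteq> 0} \<union> {J \<in> subspaces p. inv_sum J = 0}" by auto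
  then show ?thesis
    unfolding num_subspaces_def num_zero_def num_nonzero_def
    by (subst (1) \<open>subspaces p = _\<close>) (subst card_Un_disjoint; auto)
qed

text \<open>This lowers the dimension by one. A nonzero \<open>b\<close> in \<open>ann J\<close>
  determines its hyperplane \<open>I\<close>, whereas the vector may be any element of
  \<open>J - I\<close>; so \<open>(J, b)\<close> arises from exactly
  \<open>2^(p+1) - 2^p = 2^p\<close> pairs.\<close>

lemma sum_ann_eq_sum_pairs:
  fixes F :: "'a set \<Rightarrow> 'a \<Rightarrow> real"
  shows "(\<Sum>J\<in>subspaces (Suc p). \<Sum>b\<in>ann J - {0}. F J b)
    = (\<Sum>z\<in>pairs p. F (ext (fst z) (snd z)) (coset_inv_sum (fst z) (snd z))) / 2 ^ p"
proof -
  define h where "h = (\<lambda>z::'a set \<times> 'a. (ext (fst z) (snd z), coset_inv_sum (fst z) (snd z)))"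
  define T where "T = (SIGMA J:subspaces (Suc p). ann J - {0::'a})"
  have hT: "h ` pairs p \<subseteq> T"
    using coset_inv_sum_in_ann coset_inv_sum_nonzero card_ext subspace_ext
    by (auto simp: h_def T_def pairs_def subspaces_def)
  have fib: "card {z \<in> pairs p. h z = y} = 2 ^ p" if "y \<in> T" for y
  proof -
    obtain J b where "y = (J, b)" by force
    then have y: "y = (J, b)" "J \<in> subspaces (Suc p)" "b \<in> ann J" "b \<noteq> 0"
      using that by (auto simp: T_def)
    then obtain I f where I: "F2_subspace I" "f \<notin> I" "ext I f = J" "b = coset_inv_sum I f"
      using ann_nonzero unfolding subspaces_def by blast
    have c: "card I = 2 ^ p" using y I card_ext[OF I(1,2)] by (simp add: subspaces_def)
    have "{z \<in> pairs p. h z = y} = {I} \<times> (J - I)"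
    proof (intro set_eqI iffI)
      fix z assume z: "z \<in> {z \<in> pairs p. h z = y}"
      obtain I' f' where zz: "z = (I', f')" by force
      have z': "F2_subspace I'" "f' \<notin> I'" "ext I' f' = J" "b = coset_inv_sum I' f'"
        using z y by (auto simp: zz pairs_def h_def subspaces_def)
      then have "I' = I" using I by (intro hyperplane_unique[of I' f' I f]) auto
      moreover have "f' \<in> J" using z' F2_subspaceD(1) by (auto simp: mem_ext)
      ultimately show "z \<in> {I} \<times> (J - I)" using z' zz by simp
    next
      fix z assume z: "z \<in> {I} \<times> (J - I)"
      then show "z \<in> {z \<in> pairs p. h z = y}"
        using I c y ext_eq_ext[OF I(1), of "snd z" f] coset_inv_sum_coset[OF I(1,2), of "snd z"]
        by (auto simp: pairs_def h_def subspaces_def)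
    qed
    moreover have "I \<subseteq> J" using I by (auto simp: mem_ext)
    ultimately show ?thesis
      using y c by (simp add: card_Diff_subset subspaces_def)
  qed
  have "(\<Sum>z\<in>pairs p. F (ext (fst z) (snd z)) (coset_inv_sum (fst z) (snd z)))
      = (\<Sum>z\<in>pairs p. case_prod F (h z))" by (simp add: h_def)
  also have "\<dots> = (\<Sum>y\<in>T. \<Sum>z\<in>{z \<in> pairs p. h z = y}. case_prod F (h z))"
    by (rule sum.group[symmetric]) (use hT in auto)
  also have "\<dots> = (\<Sum>y\<in>T. 2 ^ p * case_prod F y)"
    using fib by (intro sum.cong refl) simp
  also have "\<dots> = 2 ^ p * (\<Sum>J\<in>subspaces (Suc p). \<Sum>b\<in>ann J - {0}. F J b)"
    unfolding T_def sum_distrib_left by (subst sum.Sigma) (auto simp: case_prod_unfold)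
  finally show ?thesis by simp
qed

lemma card_ann_nonzero:
  assumes "J \<in> subspaces p"
  shows "real (card (ann J - {0})) = 2 ^ p - 1"
proof -
  have "card (ann J) = 2 ^ p" using assms card_ann by (simp add: subspaces_def)
  then show ?thesis by (simp add: card_Diff_subset of_nat_diff)
qed

lemma card_Compl_subspace:
  assumes "(I :: 'a set) \<in> subspaces p"
  shows "real (card (- I)) = q - 2 ^ p"
proof -
  have "card (- I) + card I = card (UNIV :: 'a set)"
    by (simp add: Compl_eq_Diff_UNIV card_Diff_subset card_mono)
  then have "real (card (- I)) + real (card I) = q" by (metis card_UNIV_eq of_nat_add)
  then show ?thesis using assms by (simp add: subspaces_def)
qed

text \<open>The recursion of the Gaussian binomial coefficients, read off from
  \<open>sum_ann_eq_sum_pairs\<close> with summand 1.\<close>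

lemma num_subspaces_Suc:
  "num_subspaces (Suc p) * (2 ^ Suc p - 1) * 2 ^ p = num_subspaces p * (q - 2 ^ p)"
proof -
  have "num_subspaces (Suc p) * (2 ^ Suc p - 1)
      = (\<Sum>J\<in>subspaces (Suc p). \<Sum>b\<in>ann (J :: 'a set) - {0}. 1)"
    using card_ann_nonzero[of _ "Suc p"] by (simp add: num_subspaces_def)
  also have "\<dots> = real (card (pairs p)) / 2 ^ p" by (subst sum_ann_eq_sum_pairs) simp
  also have "real (card (pairs p)) = (\<Sum>I\<in>subspaces p. real (card (- (I :: 'a set))))"
    by (simp add: pairs_def)
  also have "\<dots> = (\<Sum>I\<in>(subspaces p :: 'a set set). q - 2 ^ p)"
    by (intro sum.cong refl card_Compl_subspace) auto
  also have "\<dots> = num_subspaces p * (q - 2 ^ p)" by (simp add: num_subspaces_def)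
  finally show ?thesis by (simp add: field_simps)
qed

text \<open>A vector that extends \<open>I\<close> to a subspace of sum zero lies in one prescribed
  fibre of \<open>ell I\<close>, which has at most \<open>2^p\<close> elements. This cancels the
  multiplicity in \<open>sum_ann_eq_sum_pairs\<close>.\<close>

lemma num_zero_Suc: "num_zero (Suc p) * (2 ^ Suc p - 1) \<le> num_subspaces p"
proof -
  have "num_zero (Suc p) * (2 ^ Suc p - 1)
      = (\<Sum>J\<in>subspaces (Suc p). if inv_sum (J :: 'a set) = 0 then 2 ^ Suc p - 1 else 0)"
    by (simp add: num_zero_def sum.If_cases Int_def)
  also have "\<dots> = (\<Sum>J\<in>subspaces (Suc p). \<Sum>b\<in>ann (J :: 'a set) - {0}. if inv_sum J = 0 then 1 else 0)"
    using card_ann_nonzero[of _ "Suc p"] by (intro sum.cong refl) simp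
  also have "\<dots> = (\<Sum>z\<in>pairs p. if inv_sum (ext (fst z) (snd z)) = 0 then 1 else 0) / 2 ^ p"
    by (subst sum_ann_eq_sum_pairs) simp
  also have "(\<Sum>z\<in>pairs p. if inv_sum (ext (fst z) (snd z)) = 0 then 1 else (0::real))
      = (\<Sum>I\<in>subspaces p. \<Sum>f\<in>-(I :: 'a set). if inv_sum (ext I f) = 0 then 1 else 0)"
    unfolding pairs_def by (subst sum.Sigma) (auto simp: case_prod_unfold)
  also have "\<dots> \<le> (\<Sum>I\<in>(subspaces p :: 'a set set). 2 ^ p)"
  proof (rule sum_mono)
    fix I :: "'a set" assume "I \<in> subspaces p"
    then have I: "F2_subspace I" "card I = 2 ^ p" by (auto simp: subspaces_def)
    have "(\<Sum>f\<in>-I. if inv_sum (ext I f) = 0 then 1 else (0::real))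
        = real (card {f. f \<notin> I \<and> inv_sum (ext I f) = 0})"
      by (simp add: sum.If_cases Int_def)
    also have "\<dots> \<le> real (card {f. ell I f = inverse (inv_sum I)})"
    proof -
      have "{f. f \<notin> I \<and> inv_sum (ext I f) = 0} \<subseteq> {f. ell I f = inverse (inv_sum I)}"
        using inv_sum_ext[OF I(1)] by (auto simp: coset_inv_sum_eq)
      then show ?thesis by (simp add: card_mono)
    qed
    also have "\<dots> \<le> (\<Sum>b\<in>ann I. 1)"
      unfolding card_ell_fiber[OF I(1)]
      by (rule sum_mono) (metis abs_psi abs_ge_self)
    also have "\<dots> = 2 ^ p" using card_ann[OF I(1)] I(2) by simp
    finally show "(\<Sum>f\<in>-I. if inv_sum (ext I f) = 0 then 1 else (0::real)) \<le> 2 ^ p" .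
  qed
  also have "\<dots> = num_subspaces p * 2 ^ p" by (simp add: num_subspaces_def)
  finally show ?thesis by (simp add: divide_right_mono)
qed

text \<open>In the fibre formula the frequency \<open>b = 0\<close> gives
  \<open>num_nonzero\<close>. The other \<open>b\<close> are coset sums of hyperplanes, so that
  \<open>b / inv_sum J\<close> is a \<open>ratio\<close> one dimension lower.\<close>

lemma sum_ell_fibers:
  "(\<Sum>J\<in>{J \<in> subspaces (Suc p). inv_sum J \<noteq> 0}. real (card {e. ell J e = y / inv_sum J}))
    = num_nonzero (Suc p) + ratio_transform p y / 2 ^ p"
proof -
  let ?N = "{J \<in> subspaces (Suc p) :: 'a set set. inv_sum J \<noteq> 0}"
  have "(\<Sum>J\<in>?N. real (card {e. ell J e = y / inv_sum J}))
      = (\<Sum>J\<in>?N. 1 + (\<Sum>b\<in>ann J - {0}. psi (b * (y / inv_sum J))))"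
    by (intro sum.cong refl) (simp add: subspaces_def card_ell_fiber sum.remove[of _ 0])
  also have "\<dots> = num_nonzero (Suc p) + (\<Sum>J\<in>?N. \<Sum>b\<in>ann J - {0}. psi (b * (y / inv_sum J)))"
    by (simp add: sum.distrib num_nonzero_def)
  also have "(\<Sum>J\<in>?N. \<Sum>b\<in>ann J - {0}. psi (b * (y / inv_sum J)))
      = (\<Sum>J\<in>subspaces (Suc p). \<Sum>b\<in>ann J - {0}.
          if inv_sum J = 0 then 0 else psi (b * (y / inv_sum J)))"
    by (rule sum.mono_neutral_cong_left) auto
  also have "\<dots> = (\<Sum>z\<in>pairs p. if inv_sum (ext (fst z) (snd z)) = 0 then 0
        else psi (coset_inv_sum (fst z) (snd z) * (y / inv_sum (ext (fst z) (snd z))))) / 2 ^ p"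
    by (rule sum_ann_eq_sum_pairs)
  also have "(\<Sum>z\<in>pairs p. if inv_sum (ext (fst z) (snd z)) = 0 then 0
        else psi (coset_inv_sum (fst z) (snd z) * (y / inv_sum (ext (fst z) (snd z)))))
      = ratio_transform p y"
    unfolding ratio_transform_def ratio_def good_pairs_def
    by (rule sum.mono_neutral_cong_right) (auto simp: ac_simps)
  finally show ?thesis .
qed

text \<open>At \<open>y = 1\<close> the fibres consist of the vectors whose coset sum equals
  \<open>inv_sum J\<close>. Adjoining such a vector doubles the sum, which gives 0.\<close>

lemma ex_zero_sum_subspace:
  assumes "num_nonzero (Suc p) + ratio_transform p 1 / 2 ^ p \<noteq> 0"
  shows "\<exists>V::'a set. V \<in> subspaces (Suc (Suc p)) \<and> inv_sum V = 0"
proof -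
  obtain J :: "'a set" where J: "J \<in> subspaces (Suc p)" "inv_sum J \<noteq> 0"
    and "card {e. ell J e = 1 / inv_sum J} \<noteq> 0"
    using assms unfolding sum_ell_fibers[symmetric]
    by (metis (mono_tags, lifting) mem_Collect_eq of_nat_0 sum.neutral)
  then obtain e where e: "ell J e = 1 / inv_sum J" by (auto simp: card_eq_0_iff)
  then have "e \<notin> J" using J ell_eq_0_on by fastforce
  then have "inv_sum (ext J e) = 0" "ext J e \<in> subspaces (Suc (Suc p))"
    using J e inv_sum_ext[of J e] card_ext[of J e] subspace_ext[of J e]
    by (simp_all add: subspaces_def coset_inv_sum_eq)
  then show ?thesis by blast
qed

text \<open>With \<open>s = inv_sum J\<close> and \<open>l = ell J e\<close> the ratio is
  \<open>1 / (s * l + 1)\<close>, so it equals \<open>x\<close> exactly if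
  \<open>s * l = 1 + 1 / x\<close>. As \<open>x\<close> is not 1, this forces \<open>s\<close> and
  \<open>l\<close> to be nonzero.\<close>

lemma good_pairs_Suc_fiber:
  assumes x: "x \<noteq> 0" "x \<noteq> 1"
  shows "{z \<in> good_pairs (Suc p). ratio z = x}
    = (SIGMA J:{J \<in> subspaces (Suc p). inv_sum J \<noteq> 0}. {e. ell J e = (1 + 1 / x) / inv_sum J})"
proof (rule set_eqI)
  fix z :: "'a set \<times> 'a"
  obtain J e where z: "z = (J, e)" by force
  let ?s = "inv_sum J" and ?l = "ell J e"
  have y: "1 + 1 / x \<noteq> 0" using x by simp
  have "e \<notin> J \<and> inv_sum (ext J e) \<noteq> 0 \<and> ratio z = x \<longleftrightarrow> ?s \<noteq> 0 \<and> ?l = (1 + 1 / x) / ?s"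
    if J: "F2_subspace J"
  proof (cases "e \<in> J")
    case True
    then show ?thesis using y by (simp add: ell_eq_0_on)
  next
    case False
    then have l: "?l \<noteq> 0" using J ell_eq_0_iff by simp
    have i: "inv_sum (ext J e) = ?s + inverse ?l"
      using J False by (simp add: inv_sum_ext coset_inv_sum_eq)
    have r: "ratio z = inverse ?l / (?s + inverse ?l)"
      using i False by (simp add: ratio_def z coset_inv_sum_eq)
    have d: "?s + inverse ?l = (?s * ?l + 1) / ?l" using l by (simp add: field_simps)
    have "ratio z = 1 / (?s * ?l + 1)" unfolding r d using l by (simp add: field_simps)
    moreover have "w / ?l \<noteq> 0 \<and> 1 / w = x \<longleftrightarrow> w = 1 / x" for w
      using l x by (cases "w = 0") (auto simp: field_simps)
    ultimately have "inv_sum (ext J e) \<noteq> 0 \<and> ratio z = x \<longleftrightarrow> ?s * ?l + 1 = 1 / x"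
      unfolding i d by (simp del: add_eq_0)
    also have "\<dots> \<longleftrightarrow> ?s * ?l = 1 + 1 / x" by (metis add.commute add_add_self(1))
    also have "\<dots> \<longleftrightarrow> ?s \<noteq> 0 \<and> ?l = (1 + 1 / x) / ?s" using y by (auto simp: eq_divide_eq mult.commute)
    finally show ?thesis using False by simp
  qed
  then show "z \<in> {z \<in> good_pairs (Suc p). ratio z = x} \<longleftrightarrow>
    z \<in> (SIGMA J:{J \<in> subspaces (Suc p). inv_sum J \<noteq> 0}. {e. ell J e = (1 + 1 / x) / inv_sum J})"
    by (auto simp: z good_pairs_def pairs_def subspaces_def)
qed

lemma ratio_count_Suc:
  assumes "x \<noteq> 0" "x \<noteq> 1"
  shows "ratio_count (Suc p) x = num_nonzero (Suc p) + ratio_transform p (1 + 1 / x) / 2 ^ p"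
  unfolding ratio_count_def good_pairs_Suc_fiber[OF assms] sum_ell_fibers[symmetric]
  by (subst card_SigmaI) auto

lemma ratio_count_0 [simp]: "ratio_count p 0 = 0"
  using coset_inv_sum_nonzero
  by (auto simp: ratio_count_def good_pairs_def pairs_def ratio_def subspaces_def)

text \<open>Ratio 1 says that the coset contributes the whole sum, that is,
  \<open>inv_sum J = 0\<close>.\<close>

lemma ratio_count_1_le: "ratio_count p 1 \<le> num_zero p * (q - 2 ^ p)"
proof -
  have "{z \<in> good_pairs p. ratio z = 1} \<subseteq> (SIGMA J:{J \<in> subspaces p. inv_sum J = 0}. - J)"
    by (auto simp: good_pairs_def pairs_def ratio_def subspaces_def inv_sum_ext)
  then have "ratio_count p 1 \<le> real (card (SIGMA J:{J \<in> subspaces p. inv_sum J = 0}. - (J :: 'a set)))"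
    unfolding ratio_count_def by (simp add: card_mono del: card_SigmaI)
  also have "\<dots> = (\<Sum>J\<in>{J \<in> subspaces p. inv_sum J = 0}. real (card (- (J :: 'a set))))" by simp
  also have "\<dots> = (\<Sum>J\<in>{J \<in> subspaces p. inv_sum J = (0::'a)}. q - 2 ^ p)"
    by (intro sum.cong refl card_Compl_subspace) auto
  finally show ?thesis by (simp add: num_zero_def)
qed

lemma ratio_transform_eq: "ratio_transform p t = (\<Sum>x\<in>UNIV. ratio_count p x * psi (t * x))"
proof -
  have "ratio_transform p t = (\<Sum>x\<in>UNIV. \<Sum>z\<in>{z \<in> good_pairs p. ratio z = x}. psi (t * ratio z))"
    unfolding ratio_transform_def by (rule sum.group[symmetric]) auto
  then show ?thesis by (simp add: ratio_count_def)
qed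

section \<open>Mean-square estimates\<close>

lemma q_ge_2: "q \<ge> 2"
proof -
  have "card {0, 1 :: 'a} \<le> card (UNIV :: 'a set)" by (rule card_mono) auto
  then have "2 \<le> card (UNIV :: 'a set)" by simp
  then show ?thesis by (metis card_UNIV_eq of_nat_le_iff of_nat_numeral)
qed

lemma parseval:
  fixes g :: "'a \<Rightarrow> real"
  shows "(\<Sum>t\<in>UNIV. (\<Sum>x\<in>UNIV. g x * psi (t * x))\<^sup>2) = q * (\<Sum>x\<in>UNIV. (g x)\<^sup>2)"
proof -
  have "(\<Sum>t\<in>UNIV. (\<Sum>x\<in>UNIV. g x * psi (t * x))\<^sup>2)
      = (\<Sum>t\<in>UNIV. \<Sum>x\<in>UNIV. \<Sum>y\<in>UNIV. g x * g y * psi ((x + y) * t))"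
    by (simp add: power2_eq_square sum_product distrib_left distrib_right psi_add ac_simps)
  also have "\<dots> = (\<Sum>x\<in>UNIV. \<Sum>t\<in>UNIV. \<Sum>y\<in>UNIV. g x * g y * psi ((x + y) * t))"
    by (rule sum.swap)
  also have "\<dots> = (\<Sum>x\<in>UNIV. \<Sum>y\<in>UNIV. \<Sum>t\<in>UNIV. g x * g y * psi ((x + y) * t))"
    by (intro sum.cong refl sum.swap)
  also have "\<dots> = (\<Sum>x\<in>UNIV. \<Sum>y\<in>UNIV. if y = x then q * (g x)\<^sup>2 else 0)"
    by (intro sum.cong refl)
      (auto simp: sum_psi_mult power2_eq_square simp flip: sum_distrib_left)
  also have "\<dots> = q * (\<Sum>x\<in>UNIV. (g x)\<^sup>2)" by (simp add: sum_distrib_left)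
  finally show ?thesis .
qed

text \<open>Parseval in two variables for the family of points \<open>(u i, v i)\<close>. Applied to
  the expanded square of a Kloosterman sum it yields a fourth moment.\<close>

lemma parseval2:
  fixes u v :: "'i \<Rightarrow> 'a"
  assumes "finite I"
  shows "(\<Sum>a\<in>UNIV. \<Sum>b\<in>UNIV. (\<Sum>i\<in>I. psi (a * u i + b * v i))\<^sup>2)
    = q\<^sup>2 * (\<Sum>i\<in>I. real (card {j \<in> I. u j = u i \<and> v j = v i}))"
proof -
  have "(\<Sum>a\<in>UNIV. \<Sum>b\<in>UNIV. (\<Sum>i\<in>I. psi (a * u i + b * v i))\<^sup>2)
      = (\<Sum>a\<in>UNIV. \<Sum>b\<in>UNIV. \<Sum>i\<in>I. \<Sum>j\<in>I. psi ((u i + u j) * a) * psi ((v i + v j) * b))"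
    by (simp add: power2_eq_square sum_product distrib_left distrib_right psi_add ac_simps)
  also have "\<dots> = (\<Sum>a\<in>UNIV. \<Sum>i\<in>I. \<Sum>j\<in>I. \<Sum>b\<in>UNIV. psi ((u i + u j) * a) * psi ((v i + v j) * b))"
    by (intro sum.cong refl, subst sum.swap, intro sum.cong refl, rule sum.swap)
  also have "\<dots> = (\<Sum>i\<in>I. \<Sum>j\<in>I. \<Sum>a\<in>UNIV. \<Sum>b\<in>UNIV. psi ((u i + u j) * a) * psi ((v i + v j) * b))"
    by (subst sum.swap, intro sum.cong refl, rule sum.swap)
  also have "\<dots> = (\<Sum>i\<in>I. \<Sum>j\<in>I. (\<Sum>a\<in>UNIV. psi ((u i + u j) * a)) * (\<Sum>b\<in>UNIV. psi ((v i + v j) * b)))"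
    by (simp add: sum_product)
  also have "\<dots> = (\<Sum>i\<in>I. \<Sum>j\<in>I. if u j = u i \<and> v j = v i then q\<^sup>2 else 0)"
    by (intro sum.cong refl) (auto simp: sum_psi_mult power2_eq_square)
  also have "\<dots> = q\<^sup>2 * (\<Sum>i\<in>I. real (card {j \<in> I. u j = u i \<and> v j = v i}))"
    using assms by (simp add: sum.If_cases sum_distrib_left Int_def mult.commute)
  finally show ?thesis .
qed

section \<open>The Kloosterman sum\<close>

definition kloosterman :: real where
  "kloosterman = (\<Sum>x\<in>UNIV - {0}. psi (x + 1 / x))"

text \<open>Kloosterman's fourth moment argument: the sum occurs \<open>q - 1\<close> times in the family with
  parameters \<open>a\<close>, \<open>b\<close>, namely whenever \<open>a * b = 1\<close>.\<close>

lemma kloosterman_fourth_power: "kloosterman ^ 4 \<le> 3 * q ^ 3"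
proof -
  define X where "X = UNIV - {0::'a}"
  have cX: "real (card X) = q - 1"
  proof -
    have "card (UNIV :: 'a set) = Suc (card X)" unfolding X_def by (rule card.remove) auto
    then show ?thesis using card_UNIV_eq by simp
  qed
  define W where "W = (\<lambda>a b. \<Sum>x\<in>X. psi (a * x + b * (1 / x)))"
  have Wa: "W a (1 / a) = kloosterman" if "a \<noteq> 0" for a
    unfolding W_def kloosterman_def X_def
    by (rule sum.reindex_bij_witness[of _ "\<lambda>x. x / a" "\<lambda>x. a * x"]) (use that in auto)
  have W2: "(W a b)\<^sup>2 = (\<Sum>i\<in>X \<times> X. psi (a * (fst i + snd i) + b * (1 / fst i + 1 / snd i)))" for a b
    unfolding W_def power2_eq_square sum_product
    by (simp add: sum.cartesian_product case_prod_unfold psi_add distrib_left ac_simps)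
  \<comment> \<open>Sum and sum of inverses determine a pair up to order, being equivalent to sum
    and product, unless the sum is 0. In that case all \<open>q - 1\<close> diagonal pairs
    coincide.\<close>
  have fibre: "real (card {j \<in> X \<times> X. fst j + snd j = fst i + snd i \<and>
      1 / fst j + 1 / snd j = 1 / fst i + 1 / snd i}) \<le> (if fst i = snd i then q - 1 else 2)"
    (is "real (card ?F) \<le> _") if "i \<in> X \<times> X" for i
  proof -
    obtain x y where "i = (x, y)" by force
    then have i: "i = (x, y)" "x \<noteq> 0" "y \<noteq> 0" using that by (auto simp: X_def)
    show ?thesis
    proof (cases "x = y")
      case True
      have "?F \<subseteq> (\<lambda>z. (z, z)) ` X"
      proof
        fix j assume "j \<in> ?F"
        then have "fst j \<in> X" "fst j = snd j" using True i by auto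
        then show "j \<in> (\<lambda>z. (z, z)) ` X" by (intro image_eqI[of _ _ "fst j"]) (auto simp: prod_eq_iff)
      qed
      then have "card ?F \<le> card X" by (rule surj_card_le[OF finite])
      then show ?thesis using True i cX by simp
    next
      case False
      have "?F \<subseteq> {(x, y), (y, x)}"
      proof
        fix j assume j: "j \<in> ?F"
        obtain z w where zw: "j = (z, w)" by force
        have n: "z \<noteq> 0" "w \<noteq> 0" and s: "z + w = x + y" and t: "1 / z + 1 / w = 1 / x + 1 / y"
          using j i by (auto simp: zw X_def)
        have "(x + y) / (z * w) = 1 / z + 1 / w"
          using n unfolding s[symmetric] by (simp add: add_divide_distrib add.commute)
        also have "\<dots> = (x + y) / (x * y)"
          using i unfolding t by (simp add: add_divide_distrib add.commute)
        finally have "(x + y) / (z * w) = (x + y) / (x * y)" .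
        then have "(x + y) * (x * y) = (x + y) * (z * w)"
          by (rule iffD1[OF frac_eq_eq, rotated 2]) (use n i in auto)
        then have p: "x * y = z * w" using False by simp
        have "z\<^sup>2 + z * (x + y) + x * y = 0"
          unfolding s[symmetric] p by (simp add: power2_eq_square distrib_left)
        then have "z = x \<or> z = y" by (rule quadratic_two_roots)
        then show "j \<in> {(x, y), (y, x)}" using s zw by (metis add.commute add_left_cancel insertI1 insertI2)
      qed
      then have "card ?F \<le> card {(x, y), (y, x)}" by (intro card_mono) auto
      also have "\<dots> \<le> 2" using card_insert_le_m1[of 2 "{(y, x)}" "(x, y)"] by simp
      finally have "real (card ?F) \<le> 2" by linarith
      moreover have "fst i \<noteq> snd i" using False i(1) by simp
      ultimately show ?thesis by (simp only: if_False)
    qed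
  qed
  have "(\<Sum>i\<in>X \<times> X. if fst i = snd i then q - 1 else 2)
      = (\<Sum>x\<in>X. \<Sum>y\<in>X. if x = y then q - 1 else 2)"
    by (simp add: sum.cartesian_product case_prod_unfold)
  also have "\<dots> \<le> (\<Sum>x\<in>X. \<Sum>y\<in>X. (if x = y then q - 1 else 0) + 2)"
    using q_ge_2 by (intro sum_mono) auto
  also have "\<dots> = (\<Sum>x\<in>X. 3 * (q - 1))"
    by (intro sum.cong refl) (simp add: sum.distrib cX)
  also have "\<dots> = (q - 1) * (3 * (q - 1))" by (simp add: cX)
  finally have diag: "(\<Sum>i\<in>X \<times> X. if fst i = snd i then q - 1 else 2) \<le> (q - 1) * (3 * (q - 1))" .
  have "(q - 1) * kloosterman ^ 4 = (\<Sum>a\<in>X. kloosterman ^ 4)" by (simp add: cX)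
  also have "\<dots> = (\<Sum>a\<in>X. (W a (1 / a)) ^ 4)"
    by (intro sum.cong refl) (simp add: Wa X_def)
  also have "\<dots> \<le> (\<Sum>a\<in>X. \<Sum>b\<in>UNIV. (W a b) ^ 4)"
    by (intro sum_mono member_le_sum) auto
  also have "\<dots> \<le> (\<Sum>a\<in>UNIV. \<Sum>b\<in>UNIV. (W a b) ^ 4)"
    by (intro sum_mono2 sum_nonneg) auto
  also have "\<dots> = (\<Sum>a\<in>UNIV. \<Sum>b\<in>UNIV. ((W a b)\<^sup>2)\<^sup>2)" by simp
  also have "\<dots> = q\<^sup>2 * (\<Sum>i\<in>X \<times> X. real (card {j \<in> X \<times> X. fst j + snd j = fst i + snd i \<and>
      1 / fst j + 1 / snd j = 1 / fst i + 1 / snd i}))"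
    unfolding W2 by (rule parseval2) simp
  also have "\<dots> \<le> q\<^sup>2 * (\<Sum>i\<in>X \<times> X. if fst i = snd i then q - 1 else 2)"
    by (intro mult_left_mono sum_mono fibre) auto
  also have "\<dots> \<le> q\<^sup>2 * ((q - 1) * (3 * (q - 1)))"
    by (intro mult_left_mono diag) auto
  finally have "(q - 1) * kloosterman ^ 4 \<le> (q - 1) * (q\<^sup>2 * (3 * (q - 1)))"
    by (simp only: ac_simps)
  then have "kloosterman ^ 4 \<le> q\<^sup>2 * (3 * (q - 1))" using q_ge_2 by simp
  also have "\<dots> \<le> q\<^sup>2 * (3 * q)" by (intro mult_left_mono) auto
  finally show ?thesis by (simp add: power2_eq_square power3_eq_cube)
qed

section \<open>Recursive bounds for the nontrivial frequencies\<close>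

definition energy :: "nat \<Rightarrow> real" where
  "energy p = (\<Sum>t\<in>UNIV - {0}. (ratio_transform p t)\<^sup>2)"

lemma ratio_transform_le_energy: "(ratio_transform p 1)\<^sup>2 \<le> energy p"
  unfolding energy_def by (rule member_le_sum) auto

lemma sum_psi: "(\<Sum>x\<in>UNIV. psi x) = 0"
  using sum_psi_mult[of 1] by simp

text \<open>Subtracting a constant from the counting function changes only the frequency \<open>0\<close> of its
  transform.\<close>

lemma energy_Suc_le:
  "energy (Suc p) \<le> q * ((num_nonzero (Suc p))\<^sup>2
     + (ratio_count (Suc p) 1 - num_nonzero (Suc p))\<^sup>2 + energy p / 4 ^ p)"
proof -
  let ?N = "num_nonzero (Suc p)"
  let ?g = "\<lambda>x. ratio_count (Suc p) x - ?N"
  have "energy (Suc p) = (\<Sum>t\<in>UNIV - {0}. (\<Sum>x\<in>UNIV. ?g x * psi (t * x))\<^sup>2)"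
    unfolding energy_def
  proof (intro sum.cong refl)
    fix t assume "t \<in> UNIV - {0::'a}"
    then have "(\<Sum>x\<in>UNIV. ?N * psi (t * x)) = 0"
      using sum_psi_mult[of t] by (simp flip: sum_distrib_left)
    then show "(ratio_transform (Suc p) t)\<^sup>2 = (\<Sum>x\<in>UNIV. ?g x * psi (t * x))\<^sup>2"
      by (simp add: ratio_transform_eq left_diff_distrib sum_subtractf)
  qed
  also have "\<dots> \<le> (\<Sum>t\<in>UNIV. (\<Sum>x\<in>UNIV. ?g x * psi (t * x))\<^sup>2)"
    by (rule sum_mono2) auto
  also have "\<dots> = q * (\<Sum>x\<in>UNIV. (?g x)\<^sup>2)" by (rule parseval)
  \<comment> \<open>The points 0 and 1 are split off because \<open>ratio_count_Suc\<close> says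
    nothing about them.\<close>
  also have "(\<Sum>x\<in>UNIV. (?g x)\<^sup>2) = (?g 0)\<^sup>2 + ((?g 1)\<^sup>2 + (\<Sum>x\<in>UNIV - {0} - {1}. (?g x)\<^sup>2))"
    by (simp add: sum.remove[of UNIV 0] sum.remove[of "UNIV - {0}" 1])
  also have "(\<Sum>x\<in>UNIV - {0} - {1}. (?g x)\<^sup>2)
      = (\<Sum>x\<in>UNIV - {0} - {1}. (ratio_transform p (1 + 1 / x))\<^sup>2 / 4 ^ p)"
    by (intro sum.cong refl)
      (simp add: ratio_count_Suc power2_eq_square flip: power_mult_distrib)
  also have "\<dots> = (\<Sum>x\<in>UNIV - {0} - {1}. (ratio_transform p (1 + 1 / x))\<^sup>2) / 4 ^ p"
    by (rule sum_divide_distrib[symmetric])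
  \<comment> \<open>The map from \<open>x\<close> to \<open>1 + 1 / x\<close> permutes the field
    without 0 and 1, so the previous energy reappears up to its term at 1.\<close>
  also have "(\<Sum>x\<in>UNIV - {0} - {1}. (ratio_transform p (1 + 1 / x))\<^sup>2)
      = (\<Sum>t\<in>UNIV - {0} - {1}. (ratio_transform p t)\<^sup>2)"
  proof (rule sum.reindex_bij_witness[of _ "\<lambda>t. 1 / (1 + t)" "\<lambda>x. 1 + 1 / x"])
    fix t :: 'a assume "t \<in> UNIV - {0} - {1}"
    then show "1 / (1 + t) \<in> UNIV - {0} - {1}" by (auto simp: field_simps)
  qed auto
  also have "\<dots> \<le> energy p" unfolding energy_def by (rule sum_mono2) auto
  finally have *: "energy (Suc p) \<le> q * ((?g 0)\<^sup>2 + ((?g 1)\<^sup>2 + energy p / 4 ^ p))"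
    using q_ge_2 by (simp add: divide_right_mono)
  then show ?thesis by (simp add: add.assoc)
qed

lemma num_nonneg: "num_subspaces p \<ge> 0" "num_zero p \<ge> 0" "num_nonzero p \<ge> 0"
  by (auto simp: num_subspaces_def num_zero_def num_nonzero_def)

lemma subspaces_0: "(subspaces 0 :: 'a set set) = {{0}}"
proof -
  have "J = {0}" if "F2_subspace J" "card J = 1" for J :: "'a set"
    using that F2_subspaceD(1) by (metis card_1_singletonE singletonD)
  moreover have "F2_subspace {0 :: 'a}" by (simp add: F2_subspace_def)
  moreover have "card {0 :: 'a} = 1" by simp
  ultimately show ?thesis unfolding subspaces_def power_0 by blast
qed

lemma num_subspaces_0: "num_subspaces 0 = 1"
  by (simp add: num_subspaces_def subspaces_0)

lemma num_subspaces_1: "num_subspaces (Suc 0) = q - 1"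
  using num_subspaces_Suc[of 0] num_subspaces_0 by simp

lemma num_zero_1: "num_zero (Suc 0) = 0"
proof -
  have "inv_sum J \<noteq> 0" if "J \<in> subspaces (Suc 0)" for J :: "'a set"
  proof -
    have "card J = 2" using that by (simp add: subspaces_def)
    then obtain a b where "J = {a, b}" "a \<noteq> b" by (auto simp: card_2_iff)
    then show ?thesis by (simp add: inv_sum_def)
  qed
  then have "{J \<in> subspaces (Suc 0). inv_sum J = (0::'a)} = {}" by blast
  then show ?thesis by (simp add: num_zero_def)
qed

lemma num_subspaces_pos: "2 ^ p < q \<Longrightarrow> num_subspaces p > 0"
proof (induction p)
  case 0
  then show ?case by (simp add: num_subspaces_0)
next
  case (Suc p)
  have "(2::real) ^ p > 0" by simp
  then have p: "2 ^ p < q" using Suc.prems unfolding power_Suc by linarith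
  then have "num_subspaces p * (q - 2 ^ p) > 0" using Suc.IH by simp
  then have "num_subspaces (Suc p) \<noteq> 0" using num_subspaces_Suc[of p] by auto
  then show ?case using num_nonneg(1)[of "Suc p"] by simp
qed

lemma ratio_count_1_bound:
  assumes "2 ^ Suc p \<le> q"
  shows "ratio_count (Suc p) 1 \<le> 2 ^ p * num_subspaces (Suc p)"
proof -
  let ?M = "2 ^ Suc p - 1 :: real"
  have M: "?M \<ge> 1" using one_le_power[of "2::real" p] by simp
  have "?M * ratio_count (Suc p) 1 \<le> ?M * (num_zero (Suc p) * (q - 2 ^ Suc p))"
    using M ratio_count_1_le[of "Suc p"] by (intro mult_left_mono) linarith+
  also have "\<dots> = num_zero (Suc p) * ?M * (q - 2 ^ Suc p)" by (simp only: ac_simps)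
  also have "\<dots> \<le> num_subspaces p * (q - 2 ^ Suc p)"
    using num_zero_Suc assms by (intro mult_right_mono) auto
  also have "\<dots> \<le> num_subspaces p * (q - 2 ^ p)"
    using num_nonneg by (intro mult_left_mono) auto
  also have "\<dots> = ?M * (2 ^ p * num_subspaces (Suc p))"
    unfolding num_subspaces_Suc[symmetric] by (simp only: ac_simps)
  finally show ?thesis using M by (simp only: mult_le_cancel_left_pos)
qed

lemma energy_Suc_bound:
  assumes "2 ^ Suc p \<le> q"
  shows "energy (Suc p) \<le> q * ((1 + 4 ^ p) * (num_subspaces (Suc p))\<^sup>2 + energy p / 4 ^ p)"
proof -
  let ?N = "num_nonzero (Suc p)" and ?G = "num_subspaces (Suc p)" and ?c = "ratio_count (Suc p) 1"
  have N: "0 \<le> ?N" "?N \<le> ?G" using num_split[of "Suc p"] num_nonneg[of "Suc p"] by auto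
  have "1 * ?G \<le> 2 ^ p * ?G" using num_nonneg by (intro mult_right_mono) auto
  moreover have "?c \<ge> 0" by (simp add: ratio_count_def)
  \<comment> \<open>Both numbers lie between 0 and \<open>2^p * ?G\<close>.\<close>
  ultimately have "\<bar>?c - ?N\<bar> \<le> \<bar>2 ^ p * ?G\<bar>" using N ratio_count_1_bound[OF assms] by linarith
  then have "(?c - ?N)\<^sup>2 \<le> (2 ^ p * ?G)\<^sup>2" by (simp only: abs_le_square_iff)
  also have "\<dots> = 4 ^ p * ?G\<^sup>2"
    by (simp add: power_mult_distrib power2_eq_square flip: power_mult_distrib)
  finally have "?N\<^sup>2 + (?c - ?N)\<^sup>2 + energy p / 4 ^ p \<le> (1 + 4 ^ p) * ?G\<^sup>2 + energy p / 4 ^ p"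
    using power_mono[OF N(2,1), of 2] by (simp add: distrib_right)
  then have "q * (?N\<^sup>2 + (?c - ?N)\<^sup>2 + energy p / 4 ^ p)
      \<le> q * ((1 + 4 ^ p) * ?G\<^sup>2 + energy p / 4 ^ p)"
    using q_ge_2 by (intro mult_left_mono) auto
  then show ?thesis using energy_Suc_le[of p] by linarith
qed

lemma ratio_transform_0: "ratio_transform 0 t = (q - 1) * psi t"
proof -
  have r: "ratio z = 1" "z \<in> good_pairs 0" if "z \<in> pairs 0" for z :: "'a set \<times> 'a"
  proof -
    obtain I e where "z = (I, e)" by force
    then have z: "z = ({0}, e)" "e \<noteq> 0" using that by (auto simp: pairs_def subspaces_0)
    then have "inv_sum (ext {0} e) = inverse e" "coset_inv_sum {0} e = inverse e"
      by (simp_all add: inv_sum_def coset_inv_sum_def ext_def)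
    then show "ratio z = 1" "z \<in> good_pairs 0" using z that by (simp_all add: ratio_def good_pairs_def)
  qed
  then have g: "good_pairs 0 = pairs 0" by (auto simp: good_pairs_def)
  have "real (card (pairs 0)) = q - 1"
  proof -
    have "real (card (pairs 0)) = (\<Sum>I\<in>subspaces 0. real (card (- (I :: 'a set))))"
      by (simp add: pairs_def)
    also have "\<dots> = (\<Sum>I\<in>(subspaces 0 :: 'a set set). q - 2 ^ 0)"
      by (intro sum.cong refl card_Compl_subspace)
    finally show ?thesis using num_subspaces_0 by (simp add: num_subspaces_def)
  qed
  then show ?thesis unfolding ratio_transform_def g by (simp add: r)
qed

lemma energy_0: "energy 0 = (q - 1) ^ 3"
proof -
  have "real (card (UNIV - {0::'a})) = q - 1"
    using card_Compl_subspace[of "{0}" 0] by (simp add: subspaces_0 Compl_eq_Diff_UNIV)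
  moreover have "energy 0 = real (card (UNIV - {0::'a})) * (q - 1)\<^sup>2"
    unfolding energy_def ratio_transform_0 power_mult_distrib psi_sq_one by simp
  ultimately show ?thesis by (simp add: power3_eq_cube power2_eq_square)
qed

lemma ratio_count_1_1: "ratio_count (Suc 0) 1 = 0"
  using ratio_count_1_le[of "Suc 0"] by (simp add: num_zero_1 ratio_count_def)

lemma num_nonzero_1: "num_nonzero (Suc 0) = q - 1"
  using num_split[of "Suc 0"] num_zero_1 num_subspaces_1 by simp

lemma energy_1_le: "energy (Suc 0) \<le> q * (q + 1) * (q - 1)\<^sup>2"
proof -
  have "energy (Suc 0) \<le> q * ((q - 1)\<^sup>2 + (0 - (q - 1))\<^sup>2 + (q - 1) ^ 3)"
    using energy_Suc_le[of 0] by (simp add: num_nonzero_1 ratio_count_1_1 energy_0)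
  also have "\<dots> = q * (q + 1) * (q - 1)\<^sup>2" by (simp add: power2_eq_square power3_eq_cube algebra_simps)
  finally show ?thesis .
qed

lemma energy_2_le:
  assumes "q \<ge> 1000"
  shows "energy (Suc (Suc 0)) \<le> 16 * q * (num_subspaces (Suc (Suc 0)))\<^sup>2"
proof -
  define G where "G = num_subspaces (Suc (Suc 0))"
  have G: "6 * G = (q - 1) * (q - 2)"
    using num_subspaces_Suc[of "Suc 0"] by (simp add: num_subspaces_1 G_def)
  \<comment> \<open>The target splits as 16 = 5 + 11. The 5 is the coefficient
    \<open>1 + 4^1\<close> of \<open>energy_Suc_bound\<close>, so \<open>energy 1 / 4\<close> must
    be at most \<open>11 * G^2\<close>. By \<open>6 * G = (q - 1) * (q - 2)\<close> this reduces to
    the present inequality.\<close>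
  have "9 * (q * (q + 1)) \<le> 11 * (q - 2)\<^sup>2"
  proof -
    have "53 * q \<le> 2 * q * q" using assms by simp
    then show ?thesis by (simp add: power2_eq_square algebra_simps)
  qed
  then have "9 * (q * (q + 1)) * (q - 1)\<^sup>2 \<le> 11 * (q - 2)\<^sup>2 * (q - 1)\<^sup>2"
    by (intro mult_right_mono) auto
  also have "\<dots> = 11 * (6 * G)\<^sup>2" unfolding G by (simp add: power_mult_distrib)
  finally have "q * (q + 1) * (q - 1)\<^sup>2 / 4 \<le> 11 * G\<^sup>2" by (simp add: power_mult_distrib)
  then have "energy (Suc 0) / 4 \<le> 11 * G\<^sup>2" using energy_1_le by linarith
  then have "q * (5 * G\<^sup>2 + energy (Suc 0) / 4) \<le> q * (16 * G\<^sup>2)"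
    using q_ge_2 by (intro mult_left_mono) auto
  moreover have "energy (Suc (Suc 0)) \<le> q * (5 * G\<^sup>2 + energy (Suc 0) / 4)"
    using energy_Suc_bound[of "Suc 0"] assms by (simp add: G_def)
  ultimately show ?thesis unfolding G_def[symmetric] by linarith
qed

text \<open>For \<open>q\<close> this large the inherited term \<open>energy p / 4^p\<close> costs
  at most one further \<open>G^2\<close>, and \<open>2 + 4^p\<close> is below
  \<open>4^(p+1)\<close>. The induction begins at 2 because the bound of \<open>energy_1_le\<close>
  exceeds \<open>4 * q * (q - 1)^2\<close>.\<close>

lemma energy_le:
  assumes "p \<ge> 2" "128 * 16 ^ p \<le> q"
  shows "energy p \<le> 4 ^ p * q * (num_subspaces p)\<^sup>2"
  using assms
proof (induction p rule: dec_induct)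
  case base
  then show ?case using energy_2_le by (simp add: numeral_2_eq_2)
next
  case (step p)
  define G H where "G = num_subspaces (Suc p)" and "H = num_subspaces p"
  have P: "(4::real) ^ p \<le> 16 ^ p" "(2::real) ^ p \<le> 16 ^ p" "(1::real) \<le> 2 ^ p" "(1::real) \<le> 4 ^ p"
    by (auto intro: power_mono)
  have q: "2048 * 16 ^ p \<le> q" using step by simp
  have IH: "energy p / 4 ^ p \<le> q * H\<^sup>2" using step q P by (simp add: H_def field_simps)
  have "H * (2 * 2 ^ p) \<le> H * q"
    using q P num_nonneg(1)[of p] unfolding H_def by (intro mult_left_mono) linarith+
  then have "q * H \<le> 2 * (H * (q - 2 ^ p))" by (simp add: algebra_simps)
  also have "H * (q - 2 ^ p) = G * (2 ^ Suc p - 1) * 2 ^ p"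
    using num_subspaces_Suc by (simp add: G_def H_def)
  also have "\<dots> \<le> G * 2 ^ Suc p * 2 ^ p"
    using num_nonneg by (intro mult_left_mono mult_right_mono) (auto simp: G_def)
  also have "\<dots> = 2 * 4 ^ p * G" by (simp flip: power_mult_distrib)
  \<comment> \<open>Passing to the next dimension multiplies the number of subspaces by at least
    \<open>q / (4 * 4^p)\<close>. Its square beats \<open>q\<close> as soon as
    \<open>16 * 16^p\<close> is at most \<open>q\<close>.\<close>
  finally have "(q * H)\<^sup>2 \<le> (4 * 4 ^ p * G)\<^sup>2"
    using num_nonneg(1)[of p] q_ge_2 by (intro power_mono) (auto simp: H_def)
  also have "\<dots> = 16 * 16 ^ p * G\<^sup>2"
    by (simp add: power_mult_distrib power2_eq_square flip: power_mult_distrib)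
  also have "\<dots> \<le> q * G\<^sup>2" using q P by (intro mult_right_mono; (linarith | simp))
  finally have "q * (q * H\<^sup>2) \<le> q * G\<^sup>2" by (simp add: power2_eq_square algebra_simps)
  then have "q * H\<^sup>2 \<le> G\<^sup>2" using q_ge_2 by simp
  then have "(1 + 4 ^ p) * G\<^sup>2 + energy p / 4 ^ p \<le> (2 + 4 ^ p) * G\<^sup>2"
    using IH by (simp add: algebra_simps)
  also have "\<dots> \<le> 4 ^ Suc p * G\<^sup>2"
    using P unfolding power_Suc by (intro mult_right_mono; (linarith | simp))
  finally have "q * ((1 + 4 ^ p) * G\<^sup>2 + energy p / 4 ^ p) \<le> q * (4 ^ Suc p * G\<^sup>2)"
    using q_ge_2 by (intro mult_left_mono) auto
  moreover have le: "2 ^ Suc p \<le> q" using q P unfolding power_Suc by linarith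
  note energy_Suc_bound[OF le]
  ultimately have "energy (Suc p) \<le> q * (4 ^ Suc p * G\<^sup>2)" unfolding G_def by (rule order_trans[rotated])
  then show ?case by (simp only: G_def ac_simps)
qed

section \<open>Nonvanishing of the count\<close>

lemma num_nonzero_lower:
  "num_subspaces p * (q - 2 ^ Suc p) \<le> num_nonzero (Suc p) * (2 * 4 ^ p)"
proof -
  let ?M = "2 ^ Suc p - 1 :: real"
  have "num_zero (Suc p) * ?M * 2 ^ p \<le> num_subspaces p * 2 ^ p"
    using num_zero_Suc by (intro mult_right_mono) auto
  \<comment> \<open>One \<open>2^p\<close> of \<open>2^(p+1)\<close> is already in
    \<open>num_subspaces_Suc\<close>; the other pays for the subspaces of sum zero.\<close>
  then have "num_subspaces p * (q - 2 ^ Suc p)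
      \<le> num_subspaces p * (q - 2 ^ p) - num_zero (Suc p) * ?M * 2 ^ p"
    by (simp add: algebra_simps)
  also have "\<dots> = num_nonzero (Suc p) * (?M * 2 ^ p)"
    unfolding num_subspaces_Suc[symmetric] num_split[of "Suc p"] by (simp add: algebra_simps)
  also have "\<dots> \<le> num_nonzero (Suc p) * (2 ^ Suc p * 2 ^ p)"
    using num_nonneg by (intro mult_left_mono mult_right_mono) auto
  also have "(2 ^ Suc p * 2 ^ p :: real) = 2 * 4 ^ p" by (simp flip: power_mult_distrib)
  finally show ?thesis .
qed

text \<open>Cancellation would require the frequency 1 to have size \<open>2^p * N\<close>. The
  energy bound then gives \<open>N^2 <= q * H^2\<close>, whereas \<open>N\<close> is at least
  \<open>H * q / (4 * 4^p)\<close>.\<close>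

lemma main_term_nonzero:
  assumes "p \<ge> 2" "128 * 16 ^ p \<le> q"
  shows "num_nonzero (Suc p) + ratio_transform p 1 / 2 ^ p \<noteq> 0"
proof
  define N T H where "N = num_nonzero (Suc p)" and "T = ratio_transform p 1" and "H = num_subspaces p"
  assume "num_nonzero (Suc p) + ratio_transform p 1 / 2 ^ p = 0"
  then have "T = - (2 ^ p * N)" by (simp add: N_def T_def field_simps)
  then have "T\<^sup>2 = (2 ^ p * 2 ^ p) * N\<^sup>2" by (simp add: power2_eq_square)
  also have "(2 ^ p * 2 ^ p :: real) = 4 ^ p" by (simp flip: power_mult_distrib)
  finally have "4 ^ p * N\<^sup>2 = T\<^sup>2" ..
  also have "\<dots> \<le> energy p" unfolding T_def by (rule ratio_transform_le_energy)
  also have "\<dots> \<le> 4 ^ p * (q * H\<^sup>2)" using energy_le[OF assms] by (simp only: H_def mult.assoc)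
  finally have "4 ^ p * N\<^sup>2 \<le> 4 ^ p * (q * H\<^sup>2)" .
  then have N: "N\<^sup>2 \<le> q * H\<^sup>2" by simp
  have P: "(2::real) ^ p \<le> 16 ^ p" "(1::real) \<le> 2 ^ p" by (auto intro: power_mono)
  have H: "H > 0" unfolding H_def by (rule num_subspaces_pos) (use P assms in linarith)
  have "q / 2 \<le> q - 2 ^ Suc p" using P assms unfolding power_Suc by linarith
  then have "H * (q / 2) \<le> H * (q - 2 ^ Suc p)" using H by (intro mult_left_mono) auto
  also have "\<dots> \<le> N * (2 * 4 ^ p)" using num_nonzero_lower by (simp add: H_def N_def)
  finally have "(H * (q / 2))\<^sup>2 \<le> (N * (2 * 4 ^ p))\<^sup>2"
    using H q_ge_2 by (intro power_mono) auto
  also have "\<dots> = N\<^sup>2 * (4 * 16 ^ p)"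
    by (simp add: power_mult_distrib power2_eq_square flip: power_mult_distrib)
  \<comment> \<open>Here the constant 128 enters: \<open>4 * 16^p\<close> is at most
    \<open>q / 32\<close>, and 1/32 is less than the 1/4 on the left.\<close>
  also have "\<dots> \<le> q * H\<^sup>2 * (q / 32)" using N assms q_ge_2 by (intro mult_mono) auto
  finally have "(H * q)\<^sup>2 / 4 \<le> (H * q)\<^sup>2 / 32" by (simp add: power2_eq_square algebra_simps)
  moreover have "(H * q)\<^sup>2 > 0" using H q_ge_2 by simp
  ultimately show False by linarith
qed

text \<open>For \<open>x\<close> other than 0 and 1 the count is
  \<open>(q - 1) * (1 + psi (1 + 1 / x))\<close>. Its transform at 1 is therefore a Kloosterman sum,
  corrected for the omitted points.\<close>

lemma ratio_transform_1:
  "ratio_transform (Suc 0) 1 = (q - 1) * (psi 1 * kloosterman - 1 - 2 * psi 1)"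
proof -
  have "ratio_transform (Suc 0) 1 = (\<Sum>x\<in>UNIV - {0} - {1}. ratio_count (Suc 0) x * psi x)"
    by (simp add: ratio_transform_eq sum.remove[of UNIV 0] sum.remove[of "UNIV - {0}" 1] ratio_count_1_1)
  also have "\<dots> = (\<Sum>x\<in>UNIV - {0} - {1}. (q - 1) * (psi x + psi 1 * psi (x + 1 / x)))"
    by (intro sum.cong refl)
      (auto simp: ratio_count_Suc num_nonzero_1 ratio_transform_0 psi_add algebra_simps)
  also have "\<dots> = (q - 1) * ((\<Sum>x\<in>UNIV - {0} - {1}. psi x)
      + psi 1 * (\<Sum>x\<in>UNIV - {0} - {1}. psi (x + 1 / x)))"
    by (simp add: sum.distrib sum_distrib_left distrib_left)
  also have "(\<Sum>x\<in>UNIV - {0} - {1}. psi x) = - 1 - psi 1"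
    using sum_psi by (simp add: sum.remove[of UNIV 0] sum.remove[of "UNIV - {0}" 1])
  also have "(\<Sum>x\<in>UNIV - {0} - {1}. psi (x + 1 / x)) = kloosterman - 1"
    by (simp add: kloosterman_def sum.remove[of "UNIV - {0}" 1])
  finally show ?thesis by (simp add: algebra_simps)
qed

text \<open>Cancellation would force \<open>kloosterman\<close> to have absolute value at least
  \<open>q / 5\<close>. The fourth power bound then gives \<open>q <= 3 * 5^4 = 1875\<close>, below
  the assumed \<open>2048 = 128 * 16\<close>.\<close>

lemma main_term_nonzero_1:
  assumes "q \<ge> 2048"
  shows "num_nonzero (Suc (Suc 0)) + ratio_transform (Suc 0) 1 / 2 ^ Suc 0 \<noteq> 0"
proof
  define N where "N = num_nonzero (Suc (Suc 0))"
  assume *: "num_nonzero (Suc (Suc 0)) + ratio_transform (Suc 0) 1 / 2 ^ Suc 0 = 0"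
  have "(q - 1) * (q - 4) \<le> 8 * N"
    using num_nonzero_lower[of "Suc 0"] by (simp add: num_subspaces_1 N_def)
  also have "8 * N = - 4 * ratio_transform (Suc 0) 1" using * by (simp add: N_def)
  also have "\<dots> = (q - 1) * (4 * (1 + 2 * psi 1 - psi 1 * kloosterman))"
    unfolding ratio_transform_1 by (simp add: algebra_simps)
  finally have "q - 4 \<le> 4 * (1 + 2 * psi 1 - psi 1 * kloosterman)" using assms by simp
  also have "\<dots> \<le> 4 * (3 + \<bar>kloosterman\<bar>)" using psi_values[of 1] by auto
  finally have "q / 5 \<le> \<bar>kloosterman\<bar>" using assms by simp
  then have "(q / 5) ^ 4 \<le> \<bar>kloosterman\<bar> ^ 4" using q_ge_2 by (intro power_mono) auto
  also have "\<dots> \<le> 3 * q ^ 3" using kloosterman_fourth_power by simp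
  finally have "q ^ 3 * q \<le> q ^ 3 * 1875" by (simp add: power_divide power_numeral_reduce ac_simps)
  then show False using assms by simp
qed

lemma exists_zero_sum_subspace:
  assumes "p \<ge> 1" "128 * 16 ^ p \<le> q"
  shows "\<exists>V::'a set. V \<in> subspaces (p + 2) \<and> inv_sum V = 0"
proof (cases "p = 1")
  case True
  then show ?thesis using ex_zero_sum_subspace[OF main_term_nonzero_1] assms by (simp add: numeral_3_eq_3)
next
  case False
  then show ?thesis using ex_zero_sum_subspace[OF main_term_nonzero] assms by simp
qed

end

section \<open>Existence of the character and conclusion\<close>

lemma char2_of_card:
  assumes "card (UNIV :: 'a::{field,finite} set) = 2 ^ n"
  shows "(2 :: 'a) = 0"
proof -
  \<comment> \<open>Translation by 1 permutes the field, so its cardinality \<open>2^n\<close>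
    vanishes in the field itself.\<close>
  have "(\<Sum>x\<in>(UNIV::'a set). x) = (\<Sum>x\<in>UNIV. x + 1)"
    by (rule sum.reindex_bij_witness[of _ "\<lambda>x. x + 1" "\<lambda>x. x - 1"]) auto
  then have "of_nat (card (UNIV :: 'a set)) = (0::'a)" by (simp add: sum.distrib)
  then show ?thesis using assms by simp
qed

text \<open>Taking the image of the Artin--Schreier map, which has index two, as the kernel gives the
  character of the absolute trace without any discussion of traces.\<close>

lemma char2_character_exists:
  assumes "(2 :: 'a::{field,finite}) = 0"
  shows "\<exists>psi :: 'a \<Rightarrow> real. char2_character psi (real (card (UNIV :: 'a set)))"
proof -
  have dbl: "x + x = 0" for x :: 'a using assms by (metis mult_2 mult_zero_left)
  have dbl2: "x + (x + y) = y" for x y :: 'a by (simp add: dbl flip: add.assoc)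
  have move: "x + y = z \<longleftrightarrow> x = y + z" for x y z :: 'a by (metis add.commute dbl2)
  have eq0: "x + y = 0 \<longleftrightarrow> x = y" for x y :: 'a by (simp add: move)
  define P where "P = (\<lambda>x::'a. x\<^sup>2 + x)"
  have P_add: "P (x + y) = P x + P y" for x y
    using assms by (simp add: P_def power2_sum)
  have P0: "P x = 0 \<longleftrightarrow> x = 0 \<or> x = 1" for x
  proof -
    have "P x = x * (x + 1)" by (simp add: P_def power2_eq_square distrib_left)
    then show ?thesis by (simp add: eq0)
  qed
  define R where "R = range P"
  have R_add: "x \<in> R \<Longrightarrow> y \<in> R \<Longrightarrow> x + y \<in> R" for x y
    by (auto simp: R_def simp flip: P_add)
  have "card (UNIV :: 'a set) = (\<Sum>y\<in>R. card {x. P x = y})"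
    using sum.image_gen[of "UNIV :: 'a set" "\<lambda>_. 1::nat" P] by (simp add: R_def)
  also have "\<dots> = (\<Sum>y\<in>R. 2)"
  proof (intro sum.cong refl)
    fix y assume "y \<in> R"
    then obtain x where x: "y = P x" by (auto simp: R_def)
    have "P z = y \<longleftrightarrow> z \<in> {x, x + 1}" for z
    proof -
      have "P z = y \<longleftrightarrow> P (z + x) = 0" by (simp add: x P_add eq0)
      also have "\<dots> \<longleftrightarrow> z \<in> {x, x + 1}" unfolding P0 move[of z x] by simp
      finally show ?thesis .
    qed
    then have "{z. P z = y} = {x, x + 1}" by blast
    then show "card {z. P z = y} = 2" by simp
  qed
  finally have card_R: "card (UNIV :: 'a set) = 2 * card R" by simp
  \<comment> \<open>As \<open>R\<close> has index two, \<open>R\<close> and \<open>x + R\<close> are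
    disjoint and cover the field, which places \<open>y\<close> in \<open>x + R\<close>.\<close>
  have R_compl: "x + y \<in> R" if "x \<notin> R" "y \<notin> R" for x y
  proof -
    have "R \<inter> (\<lambda>z. x + z) ` R = {}"
    proof (intro equalityI subsetI)
      fix u assume "u \<in> R \<inter> (\<lambda>z. x + z) ` R"
      then obtain z where "z \<in> R" "x + z \<in> R" by auto
      then have "(x + z) + z \<in> R" using R_add by blast
      then show "u \<in> {}" using that dbl by (simp add: add.assoc)
    qed simp
    moreover have "card ((\<lambda>z. x + z) ` R) = card R" by (simp add: card_image)
    ultimately have "card (R \<union> (\<lambda>z. x + z) ` R) = card (UNIV :: 'a set)"
      by (simp add: card_Un_disjoint card_R)
    then have "R \<union> (\<lambda>z. x + z) ` R = UNIV" by (intro card_subset_eq) auto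
    then have "y \<in> R \<union> (\<lambda>z. x + z) ` R" by simp
    then obtain z where "z \<in> R" "y = x + z" using \<open>y \<notin> R\<close> by auto
    then show ?thesis by (simp add: dbl2)
  qed
  have R_mixed: "x + y \<notin> R" if "x \<in> R" "y \<notin> R" for x y
    using R_add[of x "x + y"] that by (auto simp: dbl2)
  define psi where "psi = (\<lambda>x. if x \<in> R then 1 else - 1 :: real)"
  have "char2_character psi (real (card (UNIV :: 'a set)))"
  proof
    show "psi (x + y) = psi x * psi y" for x y
      using R_add[of x y] R_compl[of x y] R_mixed[of x y] R_mixed[of y x]
      by (auto simp: psi_def add.commute)
    show "psi x = 1 \<or> psi x = - 1" for x by (simp add: psi_def)
    show "psi (x\<^sup>2) = psi x" for x
    proof -
      have "x\<^sup>2 + x \<in> R" by (auto simp: R_def P_def)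
      then have "x\<^sup>2 \<in> R \<longleftrightarrow> x \<in> R"
        using R_mixed[of "x\<^sup>2" x] R_mixed[of x "x\<^sup>2"] by (auto simp: add.commute)
      then show ?thesis by (simp add: psi_def)
    qed
    have "R \<noteq> UNIV" using card_R by auto
    then show "\<exists>x. psi x \<noteq> 1" by (auto simp: psi_def)
  qed (use assms in auto)
  then show ?thesis by blast
qed

theorem theorem1:
  fixes n k :: nat
  assumes "n > 0"
    and "card (UNIV :: 'a::{field,finite} set) = 2 ^ n"
    and "3 \<le> k"
    and "real k \<le> 3 / 13 * real n + 0.461"
  shows "\<not> kth_order_sum_free k (f_inv :: 'a \<Rightarrow> 'a)"
proof -
  obtain psi :: "'a \<Rightarrow> real" where "char2_character psi (real (card (UNIV :: 'a set)))"
    using char2_character_exists char2_of_card[OF assms(2)] by blast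
  then interpret char2_character psi "real (card (UNIV :: 'a set))" .
  define p where "p = k - 2"
  have p: "p \<ge> 1" "k = p + 2" using assms(3) by (auto simp: p_def)
  \<comment> \<open>The constant satisfies \<open>13 * 0.461 = 5.993 < 6\<close>, so integrality
    gives \<open>13 * k <= 3 * n + 5\<close>. With \<open>k = p + 2\<close> this yields
    \<open>12 * p + 21 <= 3 * n\<close>, and \<open>2^(4 * p + 7)\<close> is
    \<open>128 * 16^p\<close>.\<close>
  have "13 * real k \<le> 3 * real n + 5.993" using assms(4) by simp
  then have "real (13 * k) < real (3 * n + 6)" by simp
  then have "13 * k < 3 * n + 6" by (simp only: of_nat_less_iff)
  then have "4 * p + 7 \<le> n" using p by simp
  then have "(2::real) ^ (4 * p + 7) \<le> 2 ^ n" by (intro power_increasing) auto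
  then have "128 * 16 ^ p \<le> real (card (UNIV :: 'a set))"
    using assms(2) by (simp add: power_add power_mult)
  then obtain V :: "'a set" where V: "V \<in> subspaces k" "inv_sum V = 0"
    using exists_zero_sum_subspace p by blast
  \<comment> \<open>By convention \<open>inverse 0 = 0\<close>, so the case distinction in
    \<open>f_inv\<close> disappears.\<close>
  have "f_inv = (inverse :: 'a \<Rightarrow> 'a)" by (auto simp: f_inv_def)
  then have "(\<Sum>x\<in>V. f_inv x) = 0" using V by (simp add: inv_sum_def)
  moreover have "F2_affine_subspace k V"
    unfolding F2_affine_subspace_def
    by (rule exI[of _ 0], rule exI[of _ V]) (use V in \<open>auto simp: subspaces_def\<close>)
  ultimately show ?thesis unfolding kth_order_sum_free_def by blast
qed

end
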